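(* Let $n\ge3$ and let $M$ be a simple, convex polytope in hyperbolic space $\mathbb{H}^n$. Then $M$ is stiff (i.e. first-order rigid as a collection of facet hyperplanes constrained by the dihedral angles of $M$).
   Context: For $x,y\in\mathbb{R}^{n+1}$ put $\langle x,y\rangle_1=x_1y_1+\cdots+x_ny_n-x_{n+1}y_{n+1}$. Hyperbolic space is $\mathbb{H}^n=\{x\in\mathbb{R}^{n+1}:\langle x,x\rangle_1=-1,\ x_{n+1}>0\}$. Let $D=\{x\in\mathbb{R}^{n+1}:\langle x,x\rangle_1=1\}$. Each $p\in D$ determines the hyperplane $\{x\in\mathbb{H}^n:\langle p,x\rangle_1=0\}$ of $\mathbb{H}^n$, and every hyperplane of $\mathbb{H}^n$ arises in this way from a $p\in D$, unique up to sign. The angle of intersection of the hyperplanes determined by $p$ and $q$ is $\arccos(\langle p,q\rangle_1)$. A convex polytope $M$ in $\mathbb{H}^n$ is a bounded intersection of finitely many closed half-spaces of $\mathbb{H}^n$ with nonempty interior; it is simple if every vertex of $M$ lies in exactly $n$ facets (faces of dimension $n-1$). Let $V$ index the facets of $M$, let $p_i\in D$ ($i\in V$) be a normal of the hyperplane spanned by facet $i$ (the choice of sign does not matter), and let $E$ be the set of pairs $\{i,j\}$ of distinct facets meeting in an $(n-2)$-dimensional face of $M$. A first-order motion of $M$ under its dihedral angle constraints is a map $u:V\to\mathbb{R}^{n+1}$, $u_i=u(i)$, with $\langle p_i,u_j\rangle_1+\langle p_j,u_i\rangle_1=0$ for all $\{i,j\}\in E$ and $\langle p_i,u_i\rangle_1=0$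 for all $i\in V$. A trivial first-order motion is a map $w:D\to\mathbb{R}^{n+1}$ with $\langle x,w(y)\rangle_1+\langle y,w(x)\rangle_1=0$ and $\langle z,w(z)\rangle_1=0$ for all $x,y,z\in D$. $M$ is stiff if every first-order motion $u$ of $M$ is the restriction of a trivial first-order motion $w$, i.e. $u_i=w(p_i)$ for all $i\in V$. *)

theory Defs
  imports "HOL-Analysis.Analysis"
begin

text \<open>
  The space \<open>\<real>\<^sup>n\<^sup>+\<^sup>1\<close> is \<open>(real ^ 'n) \<times> real\<close> with \<open>n = CARD('n)\<close>; the second component is the
  last (time-like) coordinate.
\<close>

type_synonym 'n lspace = "(real ^ 'n) \<times> real"

definition lorentz :: "'n::finite lspace \<Rightarrow> 'n lspace \<Rightarrow> real" where
  "lorentz x y = fst x \<bullet> fst y - snd x * snd y"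

definition hyp_space :: "'n::finite lspace set" where
  "hyp_space = {x. lorentz x x = -1 \<and> snd x > 0}"

definition de_sitter :: "'n::finite lspace set" where
  "de_sitter = {x. lorentz x x = 1}"

definition hyp_dist :: "'n::finite lspace \<Rightarrow> 'n lspace \<Rightarrow> real" where
  "hyp_dist x y = arcosh (- lorentz x y)"

definition hyp_bounded :: "'n::finite lspace set \<Rightarrow> bool" where
  "hyp_bounded S \<longleftrightarrow> (\<exists>r. \<forall>x\<in>S. \<forall>y\<in>S. hyp_dist x y \<le> r)"

definition hyp_hyperplane :: "'n::finite lspace \<Rightarrow> 'n lspace set" where
  "hyp_hyperplane p = {x \<in> hyp_space. lorentz p x = 0}"

text \<open>The opposite half-space is \<open>hyp_halfspace (- p)\<close>.\<close>

definition hyp_halfspace :: "'n::finite lspace \<Rightarrow> 'n lspace set" where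
  "hyp_halfspace p = {x \<in> hyp_space. lorentz p x \<le> 0}"

text \<open>
  The totally geodesic subspaces of hyperbolic space are its nonempty intersections with linear
  subspaces, and their dimension is one less than the linear one.
\<close>

definition hyp_span :: "'n::finite lspace set \<Rightarrow> 'n lspace set" where
  "hyp_span S = span S \<inter> hyp_space"

definition hyp_dim :: "'n::finite lspace set \<Rightarrow> int" where
  "hyp_dim S = int (dim S) - 1"

text \<open>
  The interior is taken in hyperbolic space, whose metric topology is the subspace topology
  inherited from the ambient linear space.
\<close>

definition hyp_polytope :: "'n::finite lspace set \<Rightarrow> bool" where
  "hyp_polytope M \<longleftrightarrow>
     (\<exists>P. finite P \<and> P \<subseteq> de_sitter \<and> M = hyp_space \<inter> (\<Inter>p\<in>P. hyp_halfspace p)) \<and>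
     hyp_bounded M \<and>
     (top_of_set hyp_space) interior_of M \<noteq> {}"

text \<open>Faces are \<open>M\<close> itself and its intersections with hyperplanes bounding a half-space around \<open>M\<close>.\<close>

definition hyp_face :: "'n::finite lspace set \<Rightarrow> 'n lspace set \<Rightarrow> bool" where
  "hyp_face F M \<longleftrightarrow>
     F = M \<or> (\<exists>p\<in>de_sitter. M \<subseteq> hyp_halfspace p \<and> F = M \<inter> hyp_hyperplane p)"

definition hyp_facets :: "'n::finite lspace set \<Rightarrow> 'n lspace set set" where
  "hyp_facets M = {F. hyp_face F M \<and> hyp_dim F = int CARD('n) - 1}"

definition hyp_vertices :: "'n::finite lspace set \<Rightarrow> 'n lspace set" where
  "hyp_vertices M = {v. hyp_face {v} M}"

definition simple_polytope :: "'n::finite lspace set \<Rightarrow> bool" where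
  "simple_polytope M \<longleftrightarrow>
     (\<forall>v\<in>hyp_vertices M. card {F \<in> hyp_facets M. v \<in> F} = CARD('n))"

definition adjacent_facets :: "'n::finite lspace set \<Rightarrow> 'n lspace set \<Rightarrow> 'n lspace set \<Rightarrow> bool" where
  "adjacent_facets M F G \<longleftrightarrow>
     F \<in> hyp_facets M \<and> G \<in> hyp_facets M \<and> F \<noteq> G \<and>
     hyp_face (F \<inter> G) M \<and> hyp_dim (F \<inter> G) = int CARD('n) - 2"

text \<open>
  The facets serve as their own index set. Only the values of \<open>p\<close> and \<open>u\<close> on the facets of \<open>M\<close>,
  and of \<open>w\<close> on \<open>de_sitter\<close>, are relevant below.
\<close>

definition facet_normals ::
  "'n::finite lspace set \<Rightarrow> ('n lspace set \<Rightarrow> 'n lspace) \<Rightarrow> bool" where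
  "facet_normals M p \<longleftrightarrow>
     (\<forall>F\<in>hyp_facets M. p F \<in> de_sitter \<and> hyp_hyperplane (p F) = hyp_span F)"

definition first_order_motion ::
  "'n::finite lspace set \<Rightarrow> ('n lspace set \<Rightarrow> 'n lspace) \<Rightarrow> ('n lspace set \<Rightarrow> 'n lspace) \<Rightarrow> bool"
where
  "first_order_motion M p u \<longleftrightarrow>
     (\<forall>F G. adjacent_facets M F G \<longrightarrow> lorentz (p F) (u G) + lorentz (p G) (u F) = 0) \<and>
     (\<forall>F\<in>hyp_facets M. lorentz (p F) (u F) = 0)"

definition trivial_motion :: "('n::finite lspace \<Rightarrow> 'n lspace) \<Rightarrow> bool" where
  "trivial_motion w \<longleftrightarrow>
     (\<forall>x\<in>de_sitter. \<forall>y\<in>de_sitter. lorentz x (w y) + lorentz y (w x) = 0) \<and>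
     (\<forall>z\<in>de_sitter. lorentz z (w z) = 0)"

text \<open>Normals are determined up to sign; stiffness is required for every choice of signs.\<close>

definition stiff :: "'n::finite lspace set \<Rightarrow> bool" where
  "stiff M \<longleftrightarrow>
     (\<forall>p u. facet_normals M p \<longrightarrow> first_order_motion M p u \<longrightarrow>
        (\<exists>w. trivial_motion w \<and> (\<forall>F\<in>hyp_facets M. u F = w (p F))))"

end

theory Submission
  imports Defs
begin

text \<open>
  With \<open>flip\<close> changing the sign of the time coordinate, \<open>lorentz p x = flip p \<bullet> x\<close>, so a motion is a
  map \<open>u\<close> on the facet normals \<open>p\<close> of a simple Euclidean cone with \<open>p \<bullet> u q + q \<bullet> u p = 0\<close> for facets
  with a common vertex (extreme ray), and has to be a skew linear map. At each vertex the normals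
  are independent, so \<open>u\<close> is skew there, and it remains to compare the two ends of an edge \<open>v w\<close>.

  Subtract a skew map so that \<open>u\<close> vanishes on the facets at \<open>v\<close>, let \<open>z\<close> be the normal of the facet
  at \<open>v\<close> not containing the edge, and consider a three-dimensional face containing the edge but not
  lying in the facet \<open>z\<close>. On the facets of that face \<open>u i \<bullet> z\<close> obeys a maximum principle: at a maximum \<open>f\<close>
  (relative to a linear functional) one may assume \<open>u f = 0\<close>, and then \<open>i \<mapsto> u i \<bullet> z\<close> is a nonpositive
  support function on the edges of the polygon \<open>f\<close>, while the motion condition says that its mixed
  area with the projection of that polygon from \<open>z\<close> vanishes. Hence \<open>u i \<bullet> z = 0\<close> throughout, and
  this forces \<open>u = 0\<close> on the facets at \<open>w\<close>.
\<close>

subsection \<open>Skew maps and polyhedral cones\<close>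

text \<open>The values are prescribed one vector at a time. The defect \<open>d = c p - A p\<close>
  is orthogonal to \<open>S\<close> and to \<open>p\<close>, and \<open>q\<close>, the part of
  \<open>p\<close> orthogonal to \<open>span S\<close>, is orthogonal to \<open>S\<close> as well.
  The skew map built from \<open>q\<close> and \<open>d\<close> corrects the value at
  \<open>p\<close> without disturbing those on \<open>S\<close>.\<close>

lemma skew_extension:
  fixes S :: "'e::euclidean_space set"
  assumes "finite S" "independent S" "\<And>p q. p \<in> S \<Longrightarrow> q \<in> S \<Longrightarrow> p \<bullet> c q + q \<bullet> c p = 0"
  shows "\<exists>A. linear A \<and> (\<forall>x y. x \<bullet> A y + y \<bullet> A x = 0) \<and> (\<forall>p\<in>S. A p = c p)"
  using assms
proof (induction S rule: finite_induct)
  case empty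
  have "linear (\<lambda>x::'e. 0::'e)" by (rule linear_zero)
  then show ?case by (intro exI[of _ "\<lambda>x. 0"]) auto
next
  case (insert p S)
  have "independent S" "p \<notin> span S"
    using insert.prems(1) insert.hyps by (auto simp: independent_insert)
  then obtain A where A: "linear A" and skew: "\<And>x y. x \<bullet> A y + y \<bullet> A x = 0"
      and AS: "\<And>s. s \<in> S \<Longrightarrow> A s = c s"
    using insert.IH insert.prems(2) by (metis insertCI)
  obtain y q where y: "y \<in> span S" and q: "\<And>w. w \<in> span S \<Longrightarrow> orthogonal q w" and pyq: "p = y + q"
    using orthogonal_subspace_decomp_exists[of S p] by metis
  have "q \<noteq> 0" using y pyq \<open>p \<notin> span S\<close> by auto
  have qp: "q \<bullet> p = q \<bullet> q" using q[OF y] by (simp add: pyq inner_add_right orthogonal_def)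
  then have qp0: "q \<bullet> p \<noteq> 0" using \<open>q \<noteq> 0\<close> by simp
  define d where "d = c p - A p"
  have ds: "d \<bullet> s = 0" if "s \<in> S" for s
    using insert.prems(2)[of s p] skew[of s p] AS[OF that] that
    by (simp add: d_def inner_diff_left inner_commute[of "c p"] inner_commute[of "A p"] inner_commute[of p "c s"])
  have dp: "d \<bullet> p = 0"
    using insert.prems(2)[of p p] skew[of p p] by (simp add: d_def inner_diff_left inner_commute[of "c p"] inner_commute[of "A p"] inner_commute[of p "c s"])
  have qs: "q \<bullet> s = 0" if "s \<in> S" for s
    using q[OF span_base[OF that]] by (simp add: orthogonal_def)
  define D where "D x = A x + ((q \<bullet> x) / (q \<bullet> p)) *\<^sub>R d - ((d \<bullet> x) / (q \<bullet> p)) *\<^sub>R q" for x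
  have "linear D"
    unfolding D_def using A
    by (intro linearI) (simp_all add: linear_add linear_scale inner_add_right add_divide_distrib algebra_simps)
  moreover have "x \<bullet> D y + y \<bullet> D x = 0" for x y
    using skew[of x y] by (simp add: D_def inner_add_right inner_diff_right inner_commute algebra_simps)
  moreover have "D s = c s" if "s \<in> insert p S" for s
    using that ds dp qs AS qp0 by (auto simp: D_def) (simp add: d_def)
  ultimately show ?case by blast
qed

lemma finite_strict_step:
  fixes x d :: "'e::euclidean_space"
  assumes "finite S" "\<And>p. p \<in> S \<Longrightarrow> p \<bullet> x < 0"
  shows "\<exists>e>0. \<forall>p\<in>S. p \<bullet> (x + e *\<^sub>R d) < 0"
proof -
  have "\<forall>\<^sub>F e in at_right 0. p \<bullet> (x + e *\<^sub>R d) < 0" if "p \<in> S" for p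
  proof -
    have "((\<lambda>e. p \<bullet> (x + e *\<^sub>R d)) \<longlongrightarrow> p \<bullet> (x + 0 *\<^sub>R d)) (at_right 0)"
      by (intro tendsto_intros)
    then show ?thesis using assms(2)[OF that] by (intro order_tendstoD(2)[where y = "p \<bullet> x"]) auto
  qed
  then have "\<forall>\<^sub>F e in at_right (0::real). \<forall>p\<in>S. p \<bullet> (x + e *\<^sub>R d) < 0"
    using assms(1) by (simp add: eventually_ball_finite)
  moreover have "\<forall>\<^sub>F e in at_right (0::real). e > 0" by (simp add: eventually_at_right_less)
  ultimately have "\<forall>\<^sub>F e in at_right (0::real). e > 0 \<and> (\<forall>p\<in>S. p \<bullet> (x + e *\<^sub>R d) < 0)"
    by eventually_elim auto
  then show ?thesis using eventually_happens[of _ "at_right (0::real)"] trivial_limit_at_right_real by fastforce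
qed

lemma orthogonal_to_all_but:
  fixes S :: "'e::euclidean_space set"
  assumes "p \<notin> span S"
  obtains d where "\<And>s. s \<in> S \<Longrightarrow> s \<bullet> d = 0" "p \<bullet> d > 0"
proof -
  obtain y q where y: "y \<in> span S" and q: "\<And>w. w \<in> span S \<Longrightarrow> orthogonal q w" and pyq: "p = y + q"
    using orthogonal_subspace_decomp_exists[of S p] by metis
  have "q \<noteq> 0" using y pyq assms by auto
  then have "p \<bullet> q > 0"
    using q[OF y] by (simp add: pyq inner_add_left inner_add_right orthogonal_def inner_commute)
  then show ?thesis using q span_base by (metis that orthogonal_def inner_commute)
qed

lemma card_2_other:
  assumes "card A = 2" "j \<in> A"
  shows "\<exists>k. A = {j, k} \<and> k \<noteq> j"
  using assms by (auto simp: card_2_iff)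

section \<open>Polyhedral cones, their extreme rays and their edges\<close>

definition dual_cone :: "'e::euclidean_space set \<Rightarrow> 'e set" where
  "dual_cone N = {x. \<forall>p\<in>N. p \<bullet> x \<le> 0}"

definition tight :: "'e::euclidean_space set \<Rightarrow> 'e \<Rightarrow> 'e set" where
  "tight N x = {p \<in> N. p \<bullet> x = 0}"

text \<open>Extreme rays, each represented by its point on the slice
  \<open>h \<bullet> x = 1\<close>. Extremality is encoded by rank: the tight constraints determine
  the point up to scaling.\<close>

definition cone_vertices :: "'e::euclidean_space set \<Rightarrow> 'e \<Rightarrow> 'e set" where
  "cone_vertices N h = {v \<in> dual_cone N. h \<bullet> v = 1 \<and>
     (\<forall>x. (\<forall>p\<in>tight N v. p \<bullet> x = 0) \<longrightarrow> x \<in> span {v})}"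

lemma tight_scale: "c \<noteq> 0 \<Longrightarrow> tight N (c *\<^sub>R x) = tight N x"
  by (simp add: tight_def)

lemma dual_cone_scale: "c \<ge> 0 \<Longrightarrow> x \<in> dual_cone N \<Longrightarrow> c *\<^sub>R x \<in> dual_cone N"
  by (auto simp: dual_cone_def mult_nonneg_nonpos)

text \<open>The ratio test of the simplex method: among the constraints that increase along
  \<open>y\<close>, the smallest ratio belongs to the first wall that the ray hits.\<close>

lemma dual_cone_exit:
  assumes "finite N" "x \<in> dual_cone N" "y \<notin> dual_cone N"
  obtains t k where "t \<ge> 0" "x + t *\<^sub>R y \<in> dual_cone N" "k \<in> N" "k \<bullet> y > 0" "k \<bullet> (x + t *\<^sub>R y) = 0"
proof -
  define Q where "Q = {p \<in> N. p \<bullet> y > 0}"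
  define r where "r p = - (p \<bullet> x) / (p \<bullet> y)" for p
  have Q: "finite Q" "Q \<noteq> {}" using assms by (auto simp: Q_def dual_cone_def not_le)
  obtain k where k: "k \<in> Q" "\<And>p. p \<in> Q \<Longrightarrow> r k \<le> r p"
    using ex_is_arg_min_if_finite[OF Q, of r] by (auto simp: is_arg_min_linorder)
  have r0: "r p \<ge> 0" if "p \<in> Q" for p
    using that assms(2) by (auto simp: r_def Q_def dual_cone_def divide_nonpos_pos)
  have "p \<bullet> (x + r k *\<^sub>R y) \<le> 0" if "p \<in> N" for p
  proof (cases "p \<in> Q")
    case True
    then have "r k * (p \<bullet> y) \<le> r p * (p \<bullet> y)" using k(2)[OF True] by (intro mult_right_mono) (auto simp: Q_def)
    also have "\<dots> = - (p \<bullet> x)" using True by (simp add: r_def Q_def)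
    finally show ?thesis by (simp add: inner_add_right)
  next
    case False
    then have "r k * (p \<bullet> y) \<le> 0" using that r0[OF k(1)] by (intro mult_nonneg_nonpos) (auto simp: Q_def)
    moreover have "p \<bullet> x \<le> 0" using that assms(2) by (simp add: dual_cone_def)
    ultimately show ?thesis by (simp add: inner_add_right)
  qed
  moreover have "k \<bullet> (x + r k *\<^sub>R y) = 0" "k \<in> N" "k \<bullet> y > 0"
    using k(1) by (auto simp: r_def Q_def inner_add_right inner_diff_right)
  ultimately show ?thesis using that[of "r k" k] r0[OF k(1)] by (auto simp: dual_cone_def)
qed

text \<open>The conic form of a simple polytope: \<open>h\<close> makes the slice
  \<open>h \<bullet> x = 1\<close> bounded, and \<open>simple\<close> counts the facets at its
  vertices, \<open>DIM('e) - 1\<close> being the dimension of the slice.\<close>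

locale simple_cone =
  fixes N :: "'e::euclidean_space set" and h :: 'e
  assumes finite_N: "finite N"
    and pointed: "x \<in> dual_cone N \<Longrightarrow> x \<noteq> 0 \<Longrightarrow> h \<bullet> x > 0"
    and simple: "v \<in> cone_vertices N h \<Longrightarrow> card (tight N v) = DIM('e) - 1"
begin

abbreviation "K \<equiv> dual_cone N"
abbreviation "T \<equiv> tight N"
abbreviation "X \<equiv> cone_vertices N h"

lemma finite_T: "finite (T x)"
  using finite_N by (simp add: tight_def)

lemma vertex_nonpos: "v \<in> X \<Longrightarrow> p \<in> N \<Longrightarrow> p \<bullet> v \<le> 0"
  by (simp add: cone_vertices_def dual_cone_def)

lemma vertex_height: "v \<in> X \<Longrightarrow> h \<bullet> v = 1"
  by (simp add: cone_vertices_def)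

lemma vertex_nonzero: "v \<in> X \<Longrightarrow> v \<noteq> 0"
  using vertex_height by force

lemma vertex_kernel:
  assumes "v \<in> X" "\<And>p. p \<in> T v \<Longrightarrow> p \<bullet> x = 0"
  obtains c where "x = c *\<^sub>R v"
proof -
  have "x \<in> span {v}" using assms by (simp add: cone_vertices_def)
  then show ?thesis using that by (auto simp: span_singleton)
qed

lemma vertex_unique:
  assumes "v \<in> X" "w \<in> X" "T v \<subseteq> T w"
  shows "w = v"
proof -
  obtain c where "w = c *\<^sub>R v" using vertex_kernel[OF assms(1), of w] assms(3) by (auto simp: tight_def)
  then show ?thesis using vertex_height[OF assms(1)] vertex_height[OF assms(2)] by auto
qed

lemma finite_X: "finite X"
proof (rule finite_imageD)
  show "finite (T ` X)" by (rule finite_subset[of _ "Pow N"]) (auto simp: finite_N tight_def)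
  show "inj_on T X" using vertex_unique by (auto intro!: inj_onI)
qed

text \<open>The common kernel of \<open>T v\<close> is the line of \<open>v\<close>, so
  \<open>T v\<close> has rank \<open>DIM('e) - 1\<close>, which by simplicity is also its
  cardinality.\<close>

lemma vertex_independent:
  assumes "v \<in> X"
  shows "independent (T v)"
proof -
  have "{x. \<forall>p\<in>span (T v). orthogonal p x} = span {v}"
  proof
    show "{x. \<forall>p\<in>span (T v). orthogonal p x} \<subseteq> span {v}"
      using vertex_kernel[OF assms] by (auto simp: orthogonal_def span_base span_singleton) (metis span_base rangeI)
    show "span {v} \<subseteq> {x. \<forall>p\<in>span (T v). orthogonal p x}"
    proof
      fix x assume "x \<in> span {v}"
      then obtain c where c: "x = c *\<^sub>R v" by (auto simp: span_singleton)
      have "orthogonal x p" if "p \<in> span (T v)" for p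
        using that by (rule orthogonal_to_span) (auto simp: c orthogonal_def tight_def inner_commute)
      then show "x \<in> {x. \<forall>p\<in>span (T v). orthogonal p x}" by (simp add: orthogonal_commute)
    qed
  qed
  moreover have "dim {y \<in> UNIV. \<forall>x\<in>span (T v). orthogonal x y} + dim (span (T v)) = dim (UNIV :: 'e set)"
    by (rule dim_subspace_orthogonal_to_vectors) auto
  moreover have "dim (span {v}) = 1"
    using vertex_nonzero[OF assms] by (simp add: dim_singleton)
  ultimately have "dim (T v) = card (T v)" using simple[OF assms] by simp
  then show ?thesis using finite_T by (simp add: card_le_dim_spanning[of _ "span (T v)"] span_superset)
qed

text \<open>Moving within the smallest face of \<open>x\<close> until a new constraint becomes tight
  lowers the number of slack constraints; the induction ends when that face is a ray.\<close>

lemma vertex_above: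
  assumes "x \<in> K" "x \<noteq> 0"
  shows "\<exists>v\<in>X. T x \<subseteq> T v"
  using assms
proof (induction "card N - card (T x)" arbitrary: x rule: less_induct)
  case less
  show ?case
  proof (cases "\<forall>y. (\<forall>p\<in>T x. p \<bullet> y = 0) \<longrightarrow> y \<in> span {x}")
    case True
    define v where "v = (1 / (h \<bullet> x)) *\<^sub>R x"
    have hx: "h \<bullet> x > 0" using pointed less.prems by blast
    then have "T v = T x" "h \<bullet> v = 1" "v \<in> K" "span {v} = span {x}"
      using less.prems by (auto simp: v_def tight_scale intro!: dual_cone_scale span_image_scale[of "{x}" "\<lambda>_. 1 / (h \<bullet> x)", simplified])
    then show ?thesis using True by (auto simp: cone_vertices_def)
  next
    case False
    then obtain y0 where y0: "\<And>p. p \<in> T x \<Longrightarrow> p \<bullet> y0 = 0" "y0 \<notin> span {x}" by auto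
    then have "y0 \<noteq> 0" using span_zero by metis
    \<comment> \<open>A pointed cone contains no line, so one of the two opposite directions leaves
      it.\<close>
    then have "y0 \<notin> K \<or> - y0 \<notin> K" using pointed[of y0] pointed[of "- y0"] by auto
    then obtain y where y: "\<And>p. p \<in> T x \<Longrightarrow> p \<bullet> y = 0" "y \<notin> span {x}" "y \<notin> K"
      using y0 by (metis inner_minus_right neg_equal_0_iff_equal minus_minus span_neg)
    obtain t k where tk: "t \<ge> 0" "x + t *\<^sub>R y \<in> K" "k \<in> N" "k \<bullet> y > 0" "k \<bullet> (x + t *\<^sub>R y) = 0"
      using dual_cone_exit[OF finite_N less.prems(1) y(3)] by metis
    have ne: "x + t *\<^sub>R y \<noteq> 0"
    proof
      assume eq: "x + t *\<^sub>R y = 0"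
      with less.prems have "t \<noteq> 0" by auto
      have "t *\<^sub>R y = - x" using eq by (simp add: add_eq_0_iff)
      then have "y = (1 / t) *\<^sub>R (- x)" using \<open>t \<noteq> 0\<close> by (metis divide_self_if scaleR_one scaleR_scaleR times_divide_eq_left mult_1)
      then have "y = (- (1 / t)) *\<^sub>R x" by simp
      then show False using y(2) by (metis span_base span_scale singletonI)
    qed
    have sub: "T x \<subseteq> T (x + t *\<^sub>R y)" using y(1) by (auto simp: tight_def inner_add_right)
    have "k \<in> T (x + t *\<^sub>R y)" "k \<notin> T x" using tk y(1)[of k] by (auto simp: tight_def)
    with sub have "card (T x) < card (T (x + t *\<^sub>R y))" by (intro psubset_card_mono finite_T) auto
    moreover have "card (T (x + t *\<^sub>R y)) \<le> card N" by (intro card_mono finite_N) (auto simp: tight_def)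
    ultimately have "\<exists>v\<in>X. T (x + t *\<^sub>R y) \<subseteq> T v" by (intro less.hyps tk(2) ne) linarith
    then show ?thesis using sub by blast
  qed
qed

text \<open>Relaxing only \<open>i\<close> leads from \<open>v\<close> into the relative interior of
  a two-dimensional face of the cone. Subtracting multiples of \<open>v\<close> then leads to the
  other boundary ray of that face, where a constraint outside \<open>T v\<close> is tight.\<close>

lemma edge_exists:
  assumes "v \<in> X" "i \<in> T v"
  obtains w where "w \<in> X" "w \<noteq> v" "T v - {i} \<subseteq> T w"
proof -
  have "i \<notin> span (T v - {i})" using vertex_independent[OF assms(1)] assms(2) by (auto simp: dependent_def)
  then obtain d0 where d0: "\<And>s. s \<in> T v - {i} \<Longrightarrow> s \<bullet> d0 = 0" "i \<bullet> d0 > 0"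
    using orthogonal_to_all_but by metis
  define d where "d = - d0"
  have d: "\<And>s. s \<in> T v - {i} \<Longrightarrow> s \<bullet> d = 0" "i \<bullet> d < 0" using d0 by (auto simp: d_def)
  have "p \<bullet> v < 0" if "p \<in> N - T v" for p
    using vertex_nonpos[OF assms(1), of p] that by (auto simp: tight_def)
  then obtain e where e: "e > 0" "\<And>p. p \<in> N - T v \<Longrightarrow> p \<bullet> (v + e *\<^sub>R d) < 0"
    using finite_strict_step[of "N - T v" v d] finite_N by auto
  define x where "x = v + e *\<^sub>R d"
  have tx: "p \<bullet> x = 0" if "p \<in> T v - {i}" for p
    using that d(1) by (simp add: x_def inner_add_right tight_def)
  have ix: "i \<bullet> x < 0" using assms(2) d(2) e(1) by (auto simp: x_def inner_add_right tight_def mult_pos_neg)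
  have xK: "x \<in> K"
    unfolding dual_cone_def using tx ix e(2) by (force simp: x_def[symmetric] less_imp_le)
  have "- v \<notin> K" using pointed[of "- v"] vertex_height[OF assms(1)] vertex_nonzero[OF assms(1)] by auto
  then obtain t k where tk: "t \<ge> 0" "x + t *\<^sub>R (- v) \<in> K" "k \<in> N" "k \<bullet> (- v) > 0" "k \<bullet> (x + t *\<^sub>R (- v)) = 0"
    using dual_cone_exit[OF finite_N xK] by metis
  define w where "w = x - t *\<^sub>R v"
  have w: "w \<in> K" "k \<bullet> w = 0" using tk by (auto simp: w_def)
  have iw: "i \<bullet> w < 0" using ix assms(2) by (simp add: w_def inner_diff_right tight_def)
  have tw: "p \<bullet> w = 0" if "p \<in> T v - {i}" for p
    using that tx[OF that] by (simp add: w_def inner_diff_right tight_def)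
  have "w \<noteq> 0" using iw by auto
  then obtain w' where w': "w' \<in> X" "T w \<subseteq> T w'" using vertex_above[OF w(1)] by blast
  have "T v - {i} \<subseteq> T w" using tw by (auto simp: tight_def)
  moreover have "k \<in> T w'" "k \<notin> T v" using w' w tk by (auto simp: tight_def)
  ultimately show ?thesis using that[of w'] w' by blast
qed

lemma edge_strict:
  assumes "v \<in> X" "w \<in> X" "w \<noteq> v" "i \<in> T v" "T v - {i} \<subseteq> T w"
  shows "i \<bullet> w < 0"
proof -
  have "i \<notin> T w" using assms vertex_unique[of v w] by auto
  then show ?thesis using vertex_nonpos[OF assms(2), of i] assms(4) by (auto simp: tight_def)
qed

lemma edge_kernel:
  assumes "v \<in> X" "w \<in> X" "w \<noteq> v" "i \<in> T v" "T v - {i} \<subseteq> T w"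
    and "\<And>p. p \<in> T v - {i} \<Longrightarrow> p \<bullet> y = 0"
  obtains a b where "y = a *\<^sub>R v + b *\<^sub>R w"
proof -
  define b where "b = (i \<bullet> y) / (i \<bullet> w)"
  have "i \<bullet> w \<noteq> 0" using edge_strict[OF assms(1-5)] by simp
  then have "p \<bullet> (y - b *\<^sub>R w) = 0" if "p \<in> T v" for p
    using that assms(5) assms(6)[of p]
    by (cases "p = i") (auto simp: b_def inner_diff_right tight_def)
  then obtain a where "y - b *\<^sub>R w = a *\<^sub>R v" using vertex_kernel[OF assms(1)] by metis
  then have "y = a *\<^sub>R v + b *\<^sub>R w" by (simp add: algebra_simps)
  then show ?thesis using that by blast
qed

lemma edge_tight:
  assumes "v \<in> X" "w \<in> X" "w \<noteq> v" "i \<in> T v" "T v - {i} \<subseteq> T w"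
  obtains k where "T w = insert k (T v - {i})" "k \<in> N" "k \<notin> T v"
proof -
  have "card (T w - (T v - {i})) = card (T w) - card (T v - {i})"
    using assms(5) finite_T by (intro card_Diff_subset) auto
  also have "\<dots> = 1"
    using simple[OF assms(1)] simple[OF assms(2)] assms(4) finite_T card_gt_0_iff[of "T v"] by (simp, force)
  finally obtain k where k: "T w - (T v - {i}) = {k}" using card_1_singletonE by blast
  have "i \<notin> T w" using edge_strict[OF assms] by (auto simp: tight_def)
  then show ?thesis using k that[of k] assms(5) by (auto simp: tight_def)
qed

text \<open>A two-dimensional pointed cone has just two extreme rays. In
  \<open>w' = a *\<^sub>R v + b *\<^sub>R w\<close> the constraints \<open>i\<close> and
  \<open>k\<close> give \<open>b > 0\<close> and \<open>a \<ge> 0\<close>, and a positive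
  \<open>a\<close> would make everything tight at \<open>w'\<close> tight at \<open>v\<close>
  too.\<close>

lemma edge_unique:
  assumes v: "v \<in> X" "i \<in> T v"
    and w: "w \<in> X" "w \<noteq> v" "T v - {i} \<subseteq> T w"
    and w': "w' \<in> X" "w' \<noteq> v" "T v - {i} \<subseteq> T w'"
  shows "w' = w"
proof -
  obtain k where k: "T w = insert k (T v - {i})" "k \<in> N" "k \<notin> T v"
    using edge_tight[OF v(1) w(1,2) v(2) w(3)] by metis
  obtain a b where ab: "w' = a *\<^sub>R v + b *\<^sub>R w"
    using edge_kernel[OF v(1) w(1,2) v(2) w(3), of w'] w'(3) by (auto simp: tight_def)
  have iw: "i \<bullet> w < 0" by (rule edge_strict[OF v(1) w(1,2) v(2) w(3)])
  have iw': "i \<bullet> w' < 0" by (rule edge_strict[OF v(1) w'(1,2) v(2) w'(3)])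
  have kv: "k \<bullet> v < 0" using vertex_nonpos[OF v(1) k(2)] k by (auto simp: tight_def)
  have "k \<in> T w" using k by auto
  then have kw: "k \<bullet> w = 0" by (simp add: tight_def)
  have "i \<bullet> w' = b * (i \<bullet> w)" using v(2) by (simp add: ab inner_add_right tight_def)
  then have b: "b > 0" using iw iw' by (simp add: mult_less_0_iff)
  have "k \<bullet> w' = a * (k \<bullet> v)" by (simp add: ab inner_add_right kw)
  then have a: "a \<ge> 0" using kv vertex_nonpos[OF w'(1) k(2)] by (simp add: mult_le_0_iff)
  show ?thesis
  proof (cases "a = 0")
    case True
    then show ?thesis using ab vertex_height[OF w(1)] vertex_height[OF w'(1)] by auto
  next
    case False
    have "T w' \<subseteq> T v"
    proof
      fix p assume p: "p \<in> T w'"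
      then have pN: "p \<in> N" "a * (p \<bullet> v) + b * (p \<bullet> w) = 0" by (auto simp: tight_def ab inner_add_right)
      moreover have "a * (p \<bullet> v) \<le> 0" "b * (p \<bullet> w) \<le> 0"
        using a b vertex_nonpos[OF v(1) pN(1)] vertex_nonpos[OF w(1) pN(1)] by (auto intro: mult_nonneg_nonpos)
      ultimately have "a * (p \<bullet> v) = 0" by linarith
      then have "p \<bullet> v = 0" using False by simp
      then show "p \<in> T v" using pN by (simp add: tight_def)
    qed
    then show ?thesis using vertex_unique[OF w'(1) v(1)] w'(2) by auto
  qed
qed

subsection \<open>Motions of simple cones\<close>

text \<open>Common vertices replace adjacency, since any two facets at a vertex of a simple polytope
  are adjacent. The case \<open>p = q\<close> supplies the normalization
  \<open>p \<bullet> u p = 0\<close>.\<close>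

definition motion :: "('e \<Rightarrow> 'e) \<Rightarrow> bool" where
  "motion u \<longleftrightarrow> (\<forall>v\<in>X. \<forall>p\<in>T v. \<forall>q\<in>T v. p \<bullet> u q + q \<bullet> u p = 0)"

lemma motionD: "motion u \<Longrightarrow> v \<in> X \<Longrightarrow> p \<in> T v \<Longrightarrow> q \<in> T v \<Longrightarrow> p \<bullet> u q + q \<bullet> u p = 0"
  by (simp add: motion_def)

lemma motionD_self: "motion u \<Longrightarrow> v \<in> X \<Longrightarrow> p \<in> T v \<Longrightarrow> p \<bullet> u p = 0"
  using motionD[of u v p p] by simp

text \<open>
  Here \<open>v\<close> and \<open>w\<close> are the ends of the edge \<open>i\<close> of a polygon, and \<open>k\<close> and \<open>k'\<close> are the edges next to it.
  The point of the denominators is their symmetry in \<open>i\<close> and \<open>k\<close>: by the motion condition, the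
  terms of the two edges at a corner cancel when the left-hand side is summed over all edges.
\<close>

lemma edge_sum:
  assumes v: "v \<in> X" "w \<in> X" "w \<noteq> v" and Tv: "T v = insert i (insert k B)" "T w = insert i (insert k' B)"
    and dist: "i \<notin> B" "k \<notin> B" "i \<noteq> k" "k' \<notin> B" "i \<noteq> k'"
    and z: "z \<bullet> v < 0" "z \<bullet> w < 0"
    and proj: "\<And>p. pr p - p \<in> span (insert z B)" "\<And>p q. q \<in> insert z B \<Longrightarrow> q \<bullet> pr p = 0"
    and D: "\<And>p q. D p q = sqrt ((pr p \<bullet> pr p) * (pr q \<bullet> pr q) - (pr p \<bullet> pr q)\<^sup>2)"
    and x: "\<And>p. p \<in> insert i B \<Longrightarrow> p \<bullet> x = 0"
  shows "\<exists>l>0. (x \<bullet> k) / D i k + (x \<bullet> k') / D i k' = l * (x \<bullet> z)"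
proof -
  \<comment> \<open>Both ends are rescaled to the hyperplane where \<open>z\<close> takes the value
    -1, so that the edge vector \<open>y\<close> becomes orthogonal to \<open>z\<close>.\<close>
  define a where "a = (1 / - (z \<bullet> v)) *\<^sub>R v"
  define b where "b = (1 / - (z \<bullet> w)) *\<^sub>R w"
  define y where "y = b - a"
  have z1: "z \<bullet> a = -1" "z \<bullet> b = -1" using z by (auto simp: a_def b_def)
  have vB: "p \<bullet> v = 0" if "p \<in> insert i (insert k B)" for p using that Tv(1) by (auto simp: tight_def)
  have wB: "p \<bullet> w = 0" if "p \<in> insert i (insert k' B)" for p using that Tv(2) by (auto simp: tight_def)
  have aB: "p \<bullet> a = 0" if "p \<in> insert i (insert k B)" for p using vB[OF that] by (simp add: a_def)
  have bB: "p \<bullet> b = 0" if "p \<in> insert i (insert k' B)" for p using wB[OF that] by (simp add: b_def)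
  have Tvk: "k \<in> T v" "T v - {k} = insert i B" "T v - {k} \<subseteq> T w" using Tv dist by auto
  have Twk: "k' \<in> T w" "T w - {k'} = insert i B" "T w - {k'} \<subseteq> T v" using Tv dist by auto
  have kb: "k \<bullet> b < 0" using edge_strict[OF v Tvk(1,3)] z by (simp add: b_def divide_pos_neg divide_neg_neg mult_neg_pos)
  have ka: "k' \<bullet> a < 0" using edge_strict[OF v(2,1) v(3)[symmetric] Twk(1,3)] z by (simp add: a_def divide_neg_neg)
  have kernel: "\<exists>s t. c = s *\<^sub>R a + t *\<^sub>R b" if c: "\<And>p. p \<in> insert i B \<Longrightarrow> p \<bullet> c = 0" for c
  proof -
    obtain s t where "c = s *\<^sub>R v + t *\<^sub>R w"
      by (rule edge_kernel[OF v Tvk(1,3), of c]) (use c Tvk(2) in auto)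
    then have "c = (s * - (z \<bullet> v)) *\<^sub>R a + (t * - (z \<bullet> w)) *\<^sub>R b"
      using z by (simp add: a_def b_def)
    then show ?thesis by blast
  qed
  have y0: "y \<noteq> 0" using kb aB[of k] by (auto simp: y_def)
  have yB: "p \<bullet> y = 0" if "p \<in> insert z (insert i B)" for p
    using that aB[of p] bB[of p] z1 by (auto simp: y_def inner_diff_right)
  have span_orth: "c \<bullet> p = 0" if "p \<in> span (insert z B)" "\<And>q. q \<in> insert z B \<Longrightarrow> q \<bullet> c = 0" for c p
    using orthogonal_to_span[of p "insert z B" c] that by (auto simp: orthogonal_def inner_commute)
  have pr_inner: "c \<bullet> pr p = c \<bullet> p" if "\<And>q. q \<in> insert z B \<Longrightarrow> q \<bullet> c = 0" for c p
    using span_orth[OF proj(1)[of p] that] by (simp add: inner_diff_right)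
  have pri: "pr i \<noteq> 0"
  proof
    assume "pr i = 0"
    then have "i \<in> span (insert z B)" using proj(1)[of i] span_neg[of "- i"] by auto
    then obtain c where c: "i - c *\<^sub>R z \<in> span B" by (auto simp: span_breakdown_eq)
    have "v \<bullet> (i - c *\<^sub>R z) = 0"
      using orthogonal_to_span[OF c, of v] vB by (auto simp: orthogonal_def inner_commute)
    then have "c = 0" using vB[of i] z by (auto simp: inner_diff_right inner_commute)
    with c have "i \<in> span B" by simp
    moreover have "independent (insert i B)"
      using vertex_independent[OF v(1)] by (rule independent_mono) (auto simp: Tv)
    ultimately show False using dist by (simp add: independent_insert)
  qed
  \<comment> \<open>\<open>D i q\<close> is the area of the parallelogram on the two projections:
    base \<open>norm (pr i)\<close> times height
    \<open>\<bar>y \<bullet> q\<bar> / norm y\<close>.\<close>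
  define \<nu> where "\<nu> = norm (pr i) / norm y"
  have \<nu>: "\<nu> > 0" using pri y0 by (simp add: \<nu>_def)
  have Dk: "D i q = \<bar>y \<bullet> q\<bar> * \<nu>" for q
  proof -
    \<comment> \<open>\<open>pr i\<close> and \<open>y\<close> form an orthogonal basis of the plane containing the projections.\<close>
    define c where "c = pr q - ((pr i \<bullet> pr q) / (pr i \<bullet> pr i)) *\<^sub>R pr i - ((y \<bullet> q) / (y \<bullet> y)) *\<^sub>R y"
    have yz: "\<And>p. p \<in> insert z B \<Longrightarrow> p \<bullet> y = 0" using yB by auto
    have ypr: "y \<bullet> pr p = y \<bullet> p" for p by (rule pr_inner[OF yz])
    have yi: "y \<bullet> pr i = 0" using yB[of i] by (simp add: ypr inner_commute)
    have cy: "y \<bullet> c = 0" using y0 yi by (simp add: c_def inner_diff_right ypr)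
    have cz: "p \<bullet> c = 0" if "p \<in> insert z B" for p
      using proj(2)[OF that] yz[OF that] by (simp add: c_def inner_diff_right)
    have "pr i \<bullet> c = 0" using pri yi by (simp add: c_def inner_diff_right inner_commute[of "pr i" y])
    then have "c \<bullet> i = 0" using pr_inner[OF cz, of i] by (simp add: inner_commute)
    then have "p \<bullet> c = 0" if "p \<in> insert i B" for p using that cz[of p] by (auto simp: inner_commute[of c])
    then obtain s t where st: "c = s *\<^sub>R a + t *\<^sub>R b" using kernel by blast
    have "z \<bullet> c = 0" by (rule cz) simp
    then have "s = - t" using z1 by (simp add: st inner_add_right)
    then have "c = t *\<^sub>R y" by (simp add: st y_def algebra_simps)
    then have "c = 0" using cy y0 by auto
    then have q: "pr q = ((pr i \<bullet> pr q) / (pr i \<bullet> pr i)) *\<^sub>R pr i + ((y \<bullet> q) / (y \<bullet> y)) *\<^sub>R y"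
      by (simp add: c_def algebra_simps)
    have "pr q \<bullet> pr q = pr q \<bullet> (((pr i \<bullet> pr q) / (pr i \<bullet> pr i)) *\<^sub>R pr i + ((y \<bullet> q) / (y \<bullet> y)) *\<^sub>R y)"
      by (subst (2) q) simp
    also have "\<dots> = (pr i \<bullet> pr q)\<^sup>2 / (pr i \<bullet> pr i) + (y \<bullet> q)\<^sup>2 / (y \<bullet> y)"
      using ypr[of q] by (simp add: inner_add_right power2_eq_square inner_commute)
    finally have "(pr i \<bullet> pr i) * (pr q \<bullet> pr q) - (pr i \<bullet> pr q)\<^sup>2 = (y \<bullet> q)\<^sup>2 * ((pr i \<bullet> pr i) / (y \<bullet> y))"
      using pri by (simp add: distrib_left)
    also have "\<dots> = (\<bar>y \<bullet> q\<bar> * \<nu>)\<^sup>2"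
      by (simp add: \<nu>_def power_mult_distrib power_divide power2_norm_eq_inner)
    finally show ?thesis using \<nu> by (simp add: D)
  qed
  have yk: "y \<bullet> k = k \<bullet> b" "y \<bullet> k' = - (k' \<bullet> a)"
    using aB[of k] bB[of k'] by (auto simp: y_def inner_diff_right inner_commute[of _ k] inner_commute[of _ k'])
  have Dk1: "D i k = - (k \<bullet> b) * \<nu>" and Dk2: "D i k' = - (k' \<bullet> a) * \<nu>"
    using kb ka by (auto simp: Dk yk)
  obtain s t where st: "x = s *\<^sub>R a + t *\<^sub>R b" using kernel[of x] x by blast
  have "x \<bullet> k = t * (k \<bullet> b)" "x \<bullet> k' = s * (k' \<bullet> a)" "x \<bullet> z = - (s + t)"
    using aB[of k] bB[of k'] z1
    by (auto simp: st inner_add_right inner_commute[of _ k] inner_commute[of _ k'] inner_commute[of _ z])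
  \<comment> \<open>The normals \<open>k\<close> and \<open>k'\<close> cancel in their quotients,
    leaving \<open>- t / \<nu>\<close> and \<open>- s / \<nu>\<close>. Thus \<open>l\<close> is the
    edge length \<open>norm y\<close> measured against \<open>norm (pr i)\<close>.\<close>
  then have "(x \<bullet> k) / D i k + (x \<bullet> k') / D i k' = (1 / \<nu>) * (x \<bullet> z)"
    using ka kb \<nu> by (simp add: Dk1 Dk2 add_divide_distrib diff_divide_distrib)
  then show ?thesis using \<nu> by (intro exI[of _ "1 / \<nu>"]) auto
qed

text \<open>
  In the projection from \<open>z\<close> the facets in \<open>L\<close> are the edges of a polygon; the numbers \<open>l\<close> of
  \<open>edge_sum\<close> are its edge lengths, and their pairing with \<open>x i \<bullet> z\<close> is a mixed area.
\<close>

lemma polygon_rigidity: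
  assumes B: "card B = DIM('e) - 3" "DIM('e) \<ge> 3"
    and z: "\<And>v. v \<in> X \<Longrightarrow> B \<subseteq> T v \<Longrightarrow> z \<bullet> v < 0"
    and L: "L = (\<Union>v\<in>{v \<in> X. B \<subseteq> T v}. T v - B)"
    and xB: "\<And>i p. i \<in> L \<Longrightarrow> p \<in> insert i B \<Longrightarrow> p \<bullet> x i = 0"
    and xx: "\<And>v i k. v \<in> X \<Longrightarrow> B \<subseteq> T v \<Longrightarrow> i \<in> T v - B \<Longrightarrow> k \<in> T v - B \<Longrightarrow> i \<bullet> x k + k \<bullet> x i = 0"
    and neg: "\<And>i. i \<in> L \<Longrightarrow> x i \<bullet> z \<le> 0"
    and i: "i \<in> L"
  shows "x i \<bullet> z = 0"
proof -
  have "\<exists>y. y - p \<in> span (insert z B) \<and> (\<forall>q\<in>insert z B. q \<bullet> y = 0)" for p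
  proof -
    obtain c d where "c \<in> span (insert z B)" "\<And>w. w \<in> span (insert z B) \<Longrightarrow> orthogonal d w" "p = c + d"
      using orthogonal_subspace_decomp_exists[of "insert z B" p] by metis
    then show ?thesis
      by (intro exI[of _ d]) (auto simp: orthogonal_def inner_commute span_base intro: span_neg)
  qed
  then obtain pr where pr: "\<And>p. pr p - p \<in> span (insert z B)" "\<And>p q. q \<in> insert z B \<Longrightarrow> q \<bullet> pr p = 0"
    by metis
  define D where "D p q = sqrt ((pr p \<bullet> pr p) * (pr q \<bullet> pr q) - (pr p \<bullet> pr q)\<^sup>2)" for p q
  have D_sym: "D p q = D q p" for p q by (simp add: D_def inner_commute mult.commute)
  define XB where "XB = {v \<in> X. B \<subseteq> T v}"
  \<comment> \<open>The contribution of the corner \<open>v\<close> to the edge \<open>j\<close>.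
    The sum has a single term, for the other edge at \<open>v\<close>.\<close>
  define g where "g v j = (\<Sum>k\<in>T v - B - {j}. (x j \<bullet> k) / D j k)" for v j
  have finXB: "finite XB" using finite_X by (simp add: XB_def)
  have finL: "finite L" using finXB finite_T by (auto simp: L XB_def)
  have card2: "card (T v - B) = 2" if "v \<in> XB" for v
  proof -
    have "finite B" using that finite_T finite_subset by (auto simp: XB_def)
    then show ?thesis using that B simple[of v] by (auto simp: XB_def card_Diff_subset)
  qed
  have edge: "\<exists>l>0. (\<Sum>v\<in>{v \<in> XB. j \<in> T v - B}. g v j) = l * (x j \<bullet> z)" if j: "j \<in> L" for j
  proof -
    obtain v where v: "v \<in> XB" "j \<in> T v - B" using j by (auto simp: L XB_def)
    obtain k where k: "T v - B = {j, k}" "k \<noteq> j"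
      using card_2_other[OF card2[OF v(1)] v(2)] by blast
    then have Tv: "T v = insert j (insert k B)" using v by (auto simp: XB_def)
    have vX: "v \<in> X" "k \<in> T v" using v k by (auto simp: XB_def)
    obtain w where w: "w \<in> X" "w \<noteq> v" "T v - {k} \<subseteq> T w" using edge_exists[OF vX] by metis
    have jkB: "j \<notin> B" "k \<notin> B" using v k by auto
    have "insert j B \<subseteq> T w" using w Tv k jkB by auto
    then have wXB: "w \<in> XB" "j \<in> T w - B" using w(1) jkB by (auto simp: XB_def)
    obtain k' where k': "T w - B = {j, k'}" "k' \<noteq> j"
      using card_2_other[OF card2[OF wXB(1)] wXB(2)] by blast
    then have Tw: "T w = insert j (insert k' B)" "k' \<notin> B" using wXB by (auto simp: XB_def)
    have "{v \<in> XB. j \<in> T v - B} = {v, w}"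
    proof
      show "{v, w} \<subseteq> {v \<in> XB. j \<in> T v - B}" using v wXB by auto
      have "y = w" if "y \<in> XB" "j \<in> T y - B" "y \<noteq> v" for y
        using that by (intro edge_unique[OF vX w]) (auto simp: Tv XB_def)
      then show "{v \<in> XB. j \<in> T v - B} \<subseteq> {v, w}" by auto
    qed
    moreover have "T v - B - {j} = {k}" "T w - B - {j} = {k'}" using k k' by auto
    ultimately have "(\<Sum>v\<in>{v \<in> XB. j \<in> T v - B}. g v j) = (x j \<bullet> k) / D j k + (x j \<bullet> k') / D j k'"
      using w(2) by (auto simp: g_def)
    moreover have "\<exists>l>0. (x j \<bullet> k) / D j k + (x j \<bullet> k') / D j k' = l * (x j \<bullet> z)"
      using z[of v] z[of w] v(1) wXB(1) k(2) k'(2) jkB Tw(2) xB[OF j]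
      by (intro edge_sum[OF vX(1) w(1,2) Tv Tw(1) _ _ _ _ _ _ _ pr D_def]) (auto simp: XB_def)
    ultimately show ?thesis by simp
  qed
  have vertex: "(\<Sum>j\<in>T v - B. g v j) = 0" if v: "v \<in> XB" for v
  proof -
    obtain j k where jk: "T v - B = {j, k}" "j \<noteq> k" using card2[OF v] by (auto simp: card_2_iff)
    then have "T v - B - {j} = {k}" "T v - B - {k} = {j}" by auto
    then have "g v j = (x j \<bullet> k) / D j k" "g v k = (x k \<bullet> j) / D j k" by (auto simp: g_def D_sym)
    moreover have "x j \<bullet> k + x k \<bullet> j = 0" using xx[of v j k] v jk by (auto simp: XB_def inner_commute)
    ultimately show ?thesis using jk by (simp flip: add_divide_distrib)
  qed
  define s where "s j = (\<Sum>v\<in>{v \<in> XB. j \<in> T v - B}. g v j)" for j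
  \<comment> \<open>Double counting: summed by corners the total is zero, whereas summed by edges it
    consists of the nonpositive terms \<open>l * (x j \<bullet> z)\<close> with
    \<open>l > 0\<close>. Hence every term vanishes.\<close>
  have "(\<Sum>j\<in>L. s j) = (\<Sum>v\<in>XB. \<Sum>j\<in>{j \<in> L. j \<in> T v - B}. g v j)"
    unfolding s_def by (rule sum.swap_restrict[OF finL finXB])
  also have "\<dots> = (\<Sum>v\<in>XB. \<Sum>j\<in>T v - B. g v j)"
    by (intro sum.cong) (auto simp: L XB_def)
  finally have "(\<Sum>j\<in>L. s j) = 0" using vertex by simp
  moreover have s_le: "s j \<le> 0" if "j \<in> L" for j
    using edge[OF that] neg[OF that] by (auto simp: s_def mult_nonneg_nonpos)
  ultimately have "s i = 0" using i finL sum_nonneg_eq_0_iff[of L "\<lambda>j. - s j"] by (simp add: sum_negf)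
  then show ?thesis using edge[OF i] by (auto simp: s_def)
qed

text \<open>Projectively \<open>J\<close> cuts out a three-dimensional face, and
  \<open>\<Phi>\<close> collects its facets other than \<open>z\<close>. A first use of
  \<open>polygon_rigidity\<close> spreads a positive maximum from a facet to all its neighbours; a
  second use shows that this is impossible around an extreme maximizer.\<close>

lemma max_principle:
  assumes dim: "DIM('e) \<ge> 4"
    and v0: "v0 \<in> X" and J: "J \<subseteq> T v0" "card J = DIM('e) - 4" and z: "z \<in> T v0 - J"
    and u: "motion u" "\<And>j. j \<in> J \<Longrightarrow> u j = 0" "u z = 0"
    and i: "v1 \<in> X" "J \<subseteq> T v1" "i1 \<in> T v1 - J"
  shows "u i1 \<bullet> z \<le> 0"
proof (rule ccontr)
  assume pos: "\<not> ?thesis"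
  define XJ where "XJ = {v \<in> X. J \<subseteq> T v}"
  define \<Phi> where "\<Phi> = (\<Union>v\<in>XJ. T v - J) - {z}"
  have finXJ: "finite XJ" using finite_X by (simp add: XJ_def)
  have fin\<Phi>: "finite \<Phi>" using finXJ finite_T by (simp add: \<Phi>_def)
  have finJ: "finite J" using J(1) finite_T finite_subset by blast
  have zN: "z \<in> N" using z by (auto simp: tight_def)
  have i1: "i1 \<in> \<Phi>" using i pos u(3) by (auto simp: \<Phi>_def XJ_def)
  have \<Phi>N: "i \<in> N" if "i \<in> \<Phi>" for i using that by (auto simp: \<Phi>_def tight_def)
  \<comment> \<open>A relatively interior point of the facet that \<open>z\<close> cuts out of the
    face of \<open>J\<close>. It is therefore strictly negative on all of \<open>\<Phi>\<close> and
    can serve as a normalization.\<close>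
  define y0 where "y0 = (\<Sum>v\<in>{v \<in> XJ. z \<in> T v}. v)"
  have zy0: "z \<bullet> y0 = 0" by (simp add: y0_def inner_sum_right tight_def)
  have Jy0: "j \<bullet> y0 = 0" if "j \<in> J" for j
    using that by (auto simp: y0_def inner_sum_right tight_def XJ_def intro!: sum.neutral)
  have y0_neg: "i \<bullet> y0 < 0" if i: "i \<in> \<Phi>" for i
  proof -
    have "\<exists>w\<in>XJ. z \<in> T w \<and> i \<notin> T w"
    proof (cases "i \<in> T v0")
      case True
      then obtain w where w: "w \<in> X" "w \<noteq> v0" "T v0 - {i} \<subseteq> T w" using edge_exists[OF v0] by metis
      have "i \<notin> T w" using edge_strict[OF v0 w(1,2) True w(3)] by (auto simp: tight_def)
      moreover have "z \<in> T w" "J \<subseteq> T w" using w(3) z J(1) i by (auto simp: \<Phi>_def)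
      ultimately show ?thesis using w(1) by (auto simp: XJ_def)
    qed (use v0 z J in \<open>auto simp: XJ_def\<close>)
    then obtain w where w: "w \<in> XJ" "z \<in> T w" "i \<notin> T w" by blast
    have le: "i \<bullet> v \<le> 0" if "v \<in> XJ" for v
      using that vertex_nonpos \<Phi>N[OF i] by (auto simp: XJ_def)
    have "i \<bullet> w < 0" using le[OF w(1)] w(3) \<Phi>N[OF i] by (auto simp: tight_def)
    moreover have "i \<bullet> y0 = i \<bullet> w + (\<Sum>v\<in>{v \<in> XJ. z \<in> T v} - {w}. i \<bullet> v)"
      unfolding y0_def inner_sum_right using w finXJ by (intro sum.remove) auto
    moreover have "(\<Sum>v\<in>{v \<in> XJ. z \<in> T v} - {w}. i \<bullet> v) \<le> 0"
      using le by (intro sum_nonpos) auto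
    ultimately show ?thesis by linarith
  qed
  \<comment> \<open>The denominator matches the skew maps that send \<open>z\<close> to a multiple
    of \<open>y0\<close>: subtracting one of them from \<open>u\<close> shifts all values of
    \<open>\<psi>\<close> by the same constant.\<close>
  define \<psi> where "\<psi> i = (u i \<bullet> z) / - (i \<bullet> y0)" for i
  define \<rho> where "\<rho> i = (i \<bullet> v0) / - (i \<bullet> y0)" for i
  have \<psi>: "u i \<bullet> z = \<psi> i * - (i \<bullet> y0)" and \<rho>: "i \<bullet> v0 = \<rho> i * - (i \<bullet> y0)" if "i \<in> \<Phi>" for i
    using y0_neg[OF that] by (auto simp: \<psi>_def \<rho>_def)
  define m where "m = Max (\<psi> ` \<Phi>)"
  have m_ge: "\<psi> i \<le> m" if "i \<in> \<Phi>" for i using that fin\<Phi> by (simp add: m_def)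
  have "\<psi> i1 > 0" using pos y0_neg[OF i1] by (simp add: \<psi>_def divide_pos_neg)
  then have m: "m > 0" using m_ge[OF i1] by simp
  define S where "S = {i \<in> \<Phi>. \<psi> i = m}"
  have "m \<in> \<psi> ` \<Phi>" unfolding m_def using fin\<Phi> i1 by (intro Max_in) auto
  then have "finite S" "S \<noteq> {}" using fin\<Phi> by (auto simp: S_def)
  \<comment> \<open>Among the maximizers of \<open>\<psi>\<close>, an extreme one cannot be surrounded by other maximizers.\<close>
  then obtain f where f: "f \<in> S" and f_min: "\<And>i. i \<in> S \<Longrightarrow> \<rho> f \<le> \<rho> i"
    using ex_is_arg_min_if_finite[of S \<rho>] by (auto simp: is_arg_min_linorder)
  have f\<Phi>: "f \<in> \<Phi>" "\<psi> f = m" using f by (auto simp: S_def)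
  obtain vf where vf: "vf \<in> XJ" "f \<in> T vf" "f \<notin> J" using f\<Phi>(1) by (auto simp: \<Phi>_def)
  define B where "B = insert f J"
  \<comment> \<open>At a vertex common to \<open>f\<close> and \<open>z\<close> the motion condition
    together with \<open>u z = 0\<close> would give \<open>u f \<bullet> z = 0\<close>, contrary to
    \<open>m > 0\<close>. So the polygon \<open>f\<close> stays away from \<open>z\<close>.\<close>
  have z_neg: "z \<bullet> v < 0" if "v \<in> X" "B \<subseteq> T v" for v
  proof -
    have "z \<notin> T v"
    proof
      assume "z \<in> T v"
      then have "u f \<bullet> z = 0" using motionD[OF u(1) that(1), of z f] that(2) u(3) by (simp add: B_def inner_commute)
      then show False using \<psi>[OF f\<Phi>(1)] f\<Phi>(2) m y0_neg[OF f\<Phi>(1)] by simp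
    qed
    then show ?thesis using vertex_nonpos[OF that(1) zN] zN by (auto simp: tight_def)
  qed
  have cardB: "card B = DIM('e) - 3" "DIM('e) \<ge> 3" using J dim finJ vf(3) by (auto simp: B_def)
  have vfB: "vf \<in> X" "B \<subseteq> T vf" using vf by (auto simp: XJ_def B_def)
  have indep: "independent (insert z B)"
  proof -
    have "z \<notin> span B"
    proof
      assume "z \<in> span B"
      then have "orthogonal vf z"
        by (rule orthogonal_to_span) (use vfB in \<open>auto simp: tight_def orthogonal_def inner_commute\<close>)
      then show False using z_neg[OF vfB] by (simp add: orthogonal_def inner_commute)
    qed
    then show ?thesis
      using independent_mono[OF vertex_independent[OF vfB(1)] vfB(2)] by (simp add: independent_insert)
  qed
  have finzB: "finite (insert z B)" using finJ by (simp add: B_def)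
  have zB: "z \<notin> B" using z f\<Phi>(1) by (auto simp: B_def \<Phi>_def)
  define L where "L = (\<Union>v\<in>{v \<in> X. B \<subseteq> T v}. T v - B)"
  have L\<Phi>: "i \<in> \<Phi>" if "i \<in> L" for i
    using that z_neg by (fastforce simp: L_def \<Phi>_def B_def XJ_def tight_def)
  have S_nb: "i \<in> S" if iL: "i \<in> L" for i
  proof -
    \<comment> \<open>The skew map with these values lowers \<open>\<psi>\<close> by its maximum
      \<open>m\<close> and makes the corrected motion vanish on \<open>B\<close>, in particular at
      \<open>f\<close>.\<close>
    define c where "c p = (if p = z then m *\<^sub>R y0 else u p)" for p
    have "p \<bullet> c q + q \<bullet> c p = 0" if pq: "p \<in> insert z B" "q \<in> insert z B" for p q
    proof -
      have uB: "p \<bullet> u q + q \<bullet> u p = 0" if "p \<in> B" "q \<in> B" for p q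
        using motionD[OF u(1) vfB(1)] vfB(2) that by blast
      have "z \<bullet> u p + m * (p \<bullet> y0) = 0" if "p \<in> B" for p
        using that Jy0 u(2) \<psi>[OF f\<Phi>(1)] f\<Phi>(2) by (auto simp: B_def inner_commute)
      then show ?thesis using pq uB zy0 zB by (auto simp: c_def add.commute)
    qed
    then obtain A where A: "linear A" "\<And>x y. x \<bullet> A y + y \<bullet> A x = 0" "\<And>p. p \<in> insert z B \<Longrightarrow> A p = c p"
      using skew_extension[OF finzB indep, of c] by blast
    define x where "x i = u i - A i" for i
    have Axz: "x j \<bullet> z = u j \<bullet> z + m * (j \<bullet> y0)" for j
      using A(2)[of j z] A(3)[of z] by (simp add: x_def inner_diff_left c_def inner_commute[of "A j"])
    have xmotion: "p \<bullet> x q + q \<bullet> x p = 0" if "v \<in> X" "p \<in> T v" "q \<in> T v" for v p q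
      using motionD[OF u(1) that] A(2)[of p q] by (simp add: x_def inner_diff_right)
    have xB: "x p = 0" if "p \<in> B" for p using that A(3)[of p] zB by (auto simp: x_def c_def)
    have "x i \<bullet> z = 0"
    proof (rule polygon_rigidity[OF cardB _ L_def, where x = x])
      show "p \<bullet> x j = 0" if j: "j \<in> L" and p: "p \<in> insert j B" for j p
      proof -
        obtain v where v: "v \<in> X" "B \<subseteq> T v" "j \<in> T v" using j by (auto simp: L_def)
        show ?thesis
        proof (cases "p = j")
          case True
          then show ?thesis using xmotion[OF v(1,3,3)] by simp
        next
          case False
          then have "p \<in> B" using p by simp
          then show ?thesis using xmotion[OF v(1), of p j] v xB by auto
        qed
      qed
      show "j \<bullet> x k + k \<bullet> x j = 0" if "v \<in> X" "B \<subseteq> T v" "j \<in> T v - B" "k \<in> T v - B" for v j k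
        using xmotion[of v j k] that by blast
      show "x j \<bullet> z \<le> 0" if "j \<in> L" for j
      proof -
        have "(m - \<psi> j) * (j \<bullet> y0) \<le> 0"
          using m_ge[OF L\<Phi>[OF that]] y0_neg[OF L\<Phi>[OF that]] by (intro mult_nonneg_nonpos) auto
        then show ?thesis by (simp add: Axz \<psi>[OF L\<Phi>[OF that]] left_diff_distrib)
      qed
    qed (fact z_neg, fact iL)
    then have "(m - \<psi> i) * (i \<bullet> y0) = 0" by (simp add: Axz \<psi>[OF L\<Phi>[OF iL]] algebra_simps)
    then show ?thesis using y0_neg[OF L\<Phi>[OF iL]] L\<Phi>[OF iL] by (simp add: S_def)
  qed
  \<comment> \<open>The coefficient is chosen so that \<open>f \<bullet> d = 0\<close>. By
    minimality of \<open>\<rho> f\<close>, all neighbours of \<open>f\<close> are nonnegative on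
    \<open>d\<close>, so the skew map that kills \<open>B\<close> and sends \<open>z\<close> to
    \<open>d\<close> meets the sign condition of \<open>polygon_rigidity\<close>.\<close>
  define d where "d = v0 + \<rho> f *\<^sub>R y0"
  have id: "i \<bullet> d = (\<rho> i - \<rho> f) * - (i \<bullet> y0)" if "i \<in> \<Phi>" for i
    using \<rho>[OF that] by (simp add: d_def inner_add_right algebra_simps)
  have Bd: "p \<bullet> d = 0" if "p \<in> insert z B" for p
  proof -
    have "p \<in> J \<or> p = f \<or> p = z" using that by (auto simp: B_def)
    moreover have "j \<bullet> v0 = 0" if "j \<in> J \<or> j = z" for j using that J(1) z by (auto simp: tight_def)
    ultimately show ?thesis using id[OF f\<Phi>(1)] Jy0 zy0 by (auto simp: d_def inner_add_right)
  qed
  have d_nb: "i \<bullet> d = 0" if iL: "i \<in> L" for i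
  proof -
    define c where "c p = (if p = z then d else 0)" for p
    have "p \<bullet> c q + q \<bullet> c p = 0" if pq: "p \<in> insert z B" "q \<in> insert z B" for p q
      using Bd[OF pq(1)] Bd[OF pq(2)] by (auto simp: c_def)
    then obtain A where A: "linear A" "\<And>x y. x \<bullet> A y + y \<bullet> A x = 0" "\<And>p. p \<in> insert z B \<Longrightarrow> A p = c p"
      using skew_extension[OF finzB indep, of c] by blast
    have AB: "A p = 0" if "p \<in> B" for p using that A(3)[of p] zB by (auto simp: c_def)
    have Az: "A j \<bullet> z = - (j \<bullet> d)" for j
      using A(2)[of j z] A(3)[of z] by (simp add: c_def inner_commute)
    have "A i \<bullet> z = 0"
    proof (rule polygon_rigidity[OF cardB _ L_def, where x = A])
      show "p \<bullet> A j = 0" if j: "j \<in> L" and p: "p \<in> insert j B" for j p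
        using p A(2)[of p j] A(2)[of j j] AB by auto
      show "A j \<bullet> z \<le> 0" if "j \<in> L" for j
        using f_min[OF S_nb[OF that]] y0_neg[OF L\<Phi>[OF that]]
        by (simp add: Az id[OF L\<Phi>[OF that]] mult_nonneg_nonpos)
      show "j \<bullet> A k + k \<bullet> A j = 0" for j k by (fact A(2))
    qed (fact z_neg, fact iL)
    then show ?thesis by (simp add: Az)
  qed
  have "p \<bullet> d = 0" if "p \<in> T vf" for p
    using that Bd[of p] d_nb[of p] vfB by (cases "p \<in> B") (auto simp: L_def)
  then obtain s where s: "d = s *\<^sub>R vf" using vertex_kernel[OF vfB(1)] by metis
  have "s = 0" using Bd[of z] z_neg[OF vfB] by (auto simp: s)
  then have d0: "v0 + \<rho> f *\<^sub>R y0 = 0" using s by (simp add: d_def)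
  \<comment> \<open>\<open>T v0\<close> has \<open>DIM('e) - 1\<close> elements and
    \<open>insert z J\<close> has \<open>DIM('e) - 3\<close>, so some facet in \<open>\<Phi>\<close>
    contains \<open>v0\<close>. It forces \<open>\<rho> f = 0\<close> and hence
    \<open>v0 = 0\<close>.\<close>
  have "card (T v0 - insert z J) > 0"
    using simple[OF v0] J z dim finJ by (subst card_Diff_subset) auto
  then obtain i where i: "i \<in> T v0 - insert z J" by (metis card_gt_0_iff ex_in_conv)
  then have "i \<in> \<Phi>" "i \<bullet> v0 = 0" using v0 J(1) by (auto simp: \<Phi>_def XJ_def tight_def)
  then have "\<rho> f = 0" using arg_cong[OF d0, of "\<lambda>x. i \<bullet> x"] y0_neg[of i] by (auto simp: inner_add_right)
  then show False using d0 vertex_nonzero[OF v0] by simp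
qed

section \<open>Propagation of a vanishing motion along edges\<close>

text \<open>The maximum principle for \<open>u\<close> and for its negative gives
  \<open>u k \<bullet> z = 0\<close> at the one new facet \<open>k\<close>. The motion conditions
  against the facets shared by \<open>v\<close> and \<open>w\<close> make \<open>u k\<close>
  orthogonal to the rest of \<open>T v\<close>, so it is a multiple of \<open>v\<close>. As
  \<open>k \<bullet> v\<close> is nonzero, \<open>k \<bullet> u k = 0\<close> leaves only
  zero.\<close>

lemma motion_zero_neighbour:
  assumes dim: "DIM('e) \<ge> 4"
    and v: "v \<in> X" "z \<in> T v" and w: "w \<in> X" "w \<noteq> v" "T v - {z} \<subseteq> T w"
    and u: "motion u" "\<And>p. p \<in> T v \<Longrightarrow> u p = 0" and p: "p \<in> T w"
  shows "u p = 0"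
proof (cases "p \<in> T v")
  case False
  obtain k where k: "T w = insert k (T v - {z})" "k \<in> N" "k \<notin> T v"
    using edge_tight[OF v(1) w(1,2) v(2) w(3)] by metis
  with p False have pk: "p = k" by auto
  have "card (T v - {z}) \<ge> DIM('e) - 4" using simple[OF v(1)] v(2) by simp
  then obtain J where J: "J \<subseteq> T v - {z}" "card J = DIM('e) - 4"
    using obtain_subset_with_card_n by metis
  have "motion (\<lambda>p. - u p)" using u(1) by (auto simp: motion_def neg_eq_iff_add_eq_0)
  moreover have "J \<subseteq> T v" "z \<in> T v - J" "J \<subseteq> T w" "k \<in> T w - J" using J(1) k v(2) w(3) by auto
  moreover have "u j = 0" if "j \<in> J" for j using J(1) u(2) that by auto
  moreover have "u z = 0" using u(2) v(2) by auto
  ultimately have "- u k \<bullet> z \<le> 0" "u k \<bullet> z \<le> 0"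
    using max_principle[OF dim v(1) _ J(2), of z "\<lambda>p. - u p" w k]
      max_principle[OF dim v(1) _ J(2), of z u w k] u(1) w(1) by simp_all
  then have z0: "z \<bullet> u k = 0" by (simp add: inner_commute)
  have "q \<bullet> u k = 0" if "q \<in> T v - {z}" for q
    using motionD[OF u(1) w(1), of q k] that k(1) u(2)[of q] by auto
  then have "q \<bullet> u k = 0" if "q \<in> T v" for q using that z0 by (cases "q = z") auto
  then obtain c where c: "u k = c *\<^sub>R v" using vertex_kernel[OF v(1), of "u k"] by blast
  have "k \<bullet> u k = 0" using motionD_self[OF u(1) w(1)] k(1) by blast
  then show ?thesis using c k pk by (auto simp: tight_def)
qed (use u in auto)

text \<open>As in the simplex method, \<open>v0\<close> is a multiple of \<open>v\<close> plus a
  nonnegative combination of the neighbours of \<open>v\<close>, so a functional that is smaller at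
  \<open>v0\<close> than at \<open>v\<close> is smaller at some neighbour.\<close>

lemma descending_edge:
  assumes v0: "v0 \<in> X" and v: "v \<in> X" and c: "c \<bullet> v0 < c \<bullet> v"
  obtains w i where "w \<in> X" "w \<noteq> v" "i \<in> T v" "T v - {i} \<subseteq> T w" "c \<bullet> w < c \<bullet> v"
proof -
  have "\<exists>w. w \<in> X \<and> w \<noteq> v \<and> T v - {i} \<subseteq> T w" if "i \<in> T v" for i
    using edge_exists[OF v that] by metis
  then obtain nb where nb: "\<And>i. i \<in> T v \<Longrightarrow> nb i \<in> X \<and> nb i \<noteq> v \<and> T v - {i} \<subseteq> T (nb i)"
    by metis
  have strict: "i \<bullet> nb i < 0" if "i \<in> T v" for i
    using nb[OF that] edge_strict[OF v _ _ that] by blast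
  define b where "b i = (i \<bullet> v0) / (i \<bullet> nb i)" for i
  have b: "b i \<ge> 0" if "i \<in> T v" for i
    using strict[OF that] vertex_nonpos[OF v0, of i] that by (auto simp: b_def tight_def divide_nonpos_neg)
  have "p \<bullet> (v0 - (\<Sum>i\<in>T v. b i *\<^sub>R nb i)) = 0" if p: "p \<in> T v" for p
  proof -
    have "(\<Sum>i\<in>T v - {p}. p \<bullet> (b i *\<^sub>R nb i)) = 0"
      using p nb by (intro sum.neutral) (auto simp: tight_def)
    then have "p \<bullet> (\<Sum>i\<in>T v. b i *\<^sub>R nb i) = b p * (p \<bullet> nb p)"
      unfolding inner_sum_right using finite_T p by (subst sum.remove[of _ p]) auto
    then show ?thesis using strict[OF p] by (simp add: inner_diff_right b_def)
  qed
  then obtain a where a: "v0 - (\<Sum>i\<in>T v. b i *\<^sub>R nb i) = a *\<^sub>R v" using vertex_kernel[OF v] by metis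
  \<comment> \<open>On the slice this only subtracts the constant \<open>c \<bullet> v\<close>.
    Since \<open>c'\<close> vanishes at \<open>v\<close>, the coefficient \<open>a\<close>, whose
    sign is unknown, drops out.\<close>
  define c' where "c' = c - (c \<bullet> v) *\<^sub>R h"
  have c': "c' \<bullet> x = c \<bullet> x - c \<bullet> v" if "x \<in> X" for x
    using vertex_height[OF that] by (simp add: c'_def inner_diff_left)
  have "c' \<bullet> v0 = a * (c' \<bullet> v) + (\<Sum>i\<in>T v. b i * (c' \<bullet> nb i))"
    using arg_cong[OF a, of "\<lambda>x. c' \<bullet> x"] by (simp add: inner_diff_right inner_sum_right)
  then have "(\<Sum>i\<in>T v. b i * (c' \<bullet> nb i)) < 0" using c c'[OF v0] c'[OF v] by simp
  then obtain i where i: "i \<in> T v" "b i * (c' \<bullet> nb i) < 0" by (meson not_le sum_nonneg)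
  then have "c' \<bullet> nb i < 0" using b[OF i(1)] by (simp add: mult_less_0_iff)
  then show ?thesis using that[of "nb i" i] nb[OF i(1)] i(1) c'[of "nb i"] by auto
qed

text \<open>Minus the sum of the normals at \<open>v0\<close> is minimal only at \<open>v0\<close>
  among the vertices. The lowest vertex with a nonzero value would have a lower neighbour where the
  motion vanishes, and \<open>motion_zero_neighbour\<close> carries this back along the
  edge.\<close>

lemma motion_zero:
  assumes dim: "DIM('e) \<ge> 4" and v0: "v0 \<in> X"
    and u: "motion u" "\<And>p. p \<in> T v0 \<Longrightarrow> u p = 0"
    and v: "v \<in> X" "p \<in> T v"
  shows "u p = 0"
proof (rule ccontr)
  assume "u p \<noteq> 0"
  define c where "c = - \<Sum>(T v0)"
  define S where "S = {v \<in> X. \<exists>p\<in>T v. u p \<noteq> 0}"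
  have "finite S" "S \<noteq> {}" using finite_X v \<open>u p \<noteq> 0\<close> by (auto simp: S_def)
  then obtain x where x: "x \<in> S" and x_min: "\<And>y. y \<in> S \<Longrightarrow> c \<bullet> x \<le> c \<bullet> y"
    using ex_is_arg_min_if_finite[of S "\<lambda>y. c \<bullet> y"] by (auto simp: is_arg_min_linorder)
  have xX: "x \<in> X" using x by (simp add: S_def)
  have cy: "c \<bullet> y = (\<Sum>p\<in>T v0. - (p \<bullet> y))" for y by (simp add: c_def inner_sum_left sum_negf)
  have nonneg: "- (p \<bullet> x) \<ge> 0" if "p \<in> T v0" for p using that vertex_nonpos[OF xX, of p] by (simp add: tight_def)
  have "c \<bullet> v0 = 0" by (simp add: cy tight_def)
  moreover have "c \<bullet> x \<noteq> 0"
  proof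
    assume "c \<bullet> x = 0"
    then have "\<forall>p\<in>T v0. p \<bullet> x = 0" using nonneg finite_T by (simp add: cy sum_nonneg_eq_0_iff)
    then have "T v0 \<subseteq> T x" by (auto simp: tight_def)
    then have "x = v0" by (rule vertex_unique[OF v0 xX])
    then show False using x u(2) by (auto simp: S_def)
  qed
  moreover have "c \<bullet> x \<ge> 0" unfolding cy using nonneg by (rule sum_nonneg)
  ultimately have "c \<bullet> v0 < c \<bullet> x" by simp
  then obtain w i where w: "w \<in> X" "w \<noteq> x" "i \<in> T x" "T x - {i} \<subseteq> T w" "c \<bullet> w < c \<bullet> x"
    using descending_edge[OF v0 xX] by metis
  then have "w \<notin> S" using x_min by force
  then have w0: "\<And>p. p \<in> T w \<Longrightarrow> u p = 0" using w(1) by (auto simp: S_def)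
  obtain k where k: "T w = insert k (T x - {i})" "k \<in> N" "k \<notin> T x"
    using edge_tight[OF xX w(1,2,3,4)] by metis
  then have "T w - {k} \<subseteq> T x" "k \<in> T w" by auto
  have "u q = 0" if "q \<in> T x" for q
    by (rule motion_zero_neighbour[OF dim w(1) \<open>k \<in> T w\<close> xX w(2)[symmetric] \<open>T w - {k} \<subseteq> T x\<close> u(1) w0 that])
  then show False using x by (auto simp: S_def)
qed

text \<open>The skew map is fitted at one vertex, and the difference is a motion that vanishes
  there. Through \<open>vertex_above\<close>, the assumption \<open>facets\<close> makes every
  normal tight at some vertex, where \<open>motion_zero\<close> reaches it.\<close>

theorem infinitesimal_rigidity:
  assumes dim: "DIM('e) \<ge> 4" and u: "motion u"
    and facets: "\<And>p. p \<in> N \<Longrightarrow> \<exists>x\<in>K. x \<noteq> 0 \<and> p \<bullet> x = 0"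
  shows "\<exists>A. linear A \<and> (\<forall>x y. x \<bullet> A y + y \<bullet> A x = 0) \<and> (\<forall>p\<in>N. u p = A p)"
proof (cases "X = {}")
  case True
  have "p \<notin> N" for p
  proof
    assume "p \<in> N"
    then obtain x where "x \<in> K" "x \<noteq> 0" using facets[of p] by blast
    then show False using vertex_above[of x] True by simp
  qed
  then have "N = {}" by blast
  then show ?thesis by (intro exI[of _ "\<lambda>_. 0"]) (simp add: linear_zero)
next
  case False
  then obtain v0 where v0: "v0 \<in> X" by blast
  obtain A where A: "linear A" "\<And>x y. x \<bullet> A y + y \<bullet> A x = 0" "\<And>p. p \<in> T v0 \<Longrightarrow> A p = u p"
    using skew_extension[OF finite_T vertex_independent[OF v0] motionD[OF u v0]] by blast
  have m: "motion (\<lambda>p. u p - A p)"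
    unfolding motion_def
  proof (intro ballI)
    fix v p q assume "v \<in> X" "p \<in> T v" "q \<in> T v"
    then show "p \<bullet> (u q - A q) + q \<bullet> (u p - A p) = 0"
      using motionD[OF u, of v p q] A(2)[of p q] by (simp add: inner_diff_right)
  qed
  have "u p = A p" if p: "p \<in> N" for p
  proof -
    obtain x where x: "x \<in> K" "x \<noteq> 0" "p \<bullet> x = 0" using facets[OF p] by metis
    then obtain v where "v \<in> X" "T x \<subseteq> T v" using vertex_above[OF x(1,2)] by blast
    then have v: "v \<in> X" "p \<in> T v" using x p by (auto simp: tight_def)
    have "u p - A p = 0" by (rule motion_zero[OF dim v0 m _ v]) (simp add: A(3))
    then show ?thesis by simp
  qed
  with A show ?thesis by blast
qed

end

subsection \<open>Lorentzian geometry\<close>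

definition flip :: "'n::finite lspace \<Rightarrow> 'n lspace" where
  "flip x = (fst x, - snd x)"

lemma lorentz_flip: "lorentz x y = flip x \<bullet> y"
  by (simp add: lorentz_def flip_def inner_prod_def)

lemma flip_flip [simp]: "flip (flip x) = x"
  by (simp add: flip_def)

lemma inj_flip: "inj_on flip S"
  by (metis flip_flip inj_onI)

lemma lorentz_commute: "lorentz x y = lorentz y x"
  by (simp add: lorentz_def inner_commute)

lemma linear_flip: "linear flip"
  by (intro linearI) (auto simp: flip_def)

lemma lorentz_simps:
  "lorentz (x + y) w = lorentz x w + lorentz y w" "lorentz w (x + y) = lorentz w x + lorentz w y"
  "lorentz (x - y) w = lorentz x w - lorentz y w" "lorentz w (x - y) = lorentz w x - lorentz w y"
  "lorentz (c *\<^sub>R x) w = c * lorentz x w" "lorentz w (c *\<^sub>R x) = c * lorentz w x"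
  "lorentz (- x) w = - lorentz x w" "lorentz w (- x) = - lorentz w x"
  "lorentz 0 w = 0" "lorentz w 0 = 0"
  by (simp_all add: lorentz_def algebra_simps)

lemma lorentz_sum_left: "lorentz (sum f S) w = (\<Sum>i\<in>S. lorentz (f i) w)"
  using linear_sum[OF linear_flip, of f S] by (simp add: lorentz_flip inner_sum_left)

lemma lorentz_sum_right: "lorentz w (sum f S) = (\<Sum>i\<in>S. lorentz w (f i))"
  by (simp add: lorentz_flip inner_sum_right)

lemma continuous_lorentz [continuous_intros]:
  "continuous_on S f \<Longrightarrow> continuous_on S g \<Longrightarrow> continuous_on S (\<lambda>x. lorentz (f x) (g x))"
  unfolding lorentz_def by (intro continuous_intros)

text \<open>The interior of the future light cone, that is, the open cone over hyperbolic
  space.\<close>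

definition future :: "'n::finite lspace \<Rightarrow> bool" where
  "future x \<longleftrightarrow> lorentz x x < 0 \<and> snd x > 0"

lemma future_hyp_space: "x \<in> hyp_space \<Longrightarrow> future x"
  by (simp add: future_def hyp_space_def)

lemma future_iff_norm: "future x \<longleftrightarrow> norm (fst x) < snd x"
proof -
  have "lorentz x x = (norm (fst x))\<^sup>2 - (snd x)\<^sup>2"
    by (simp add: lorentz_def power2_norm_eq_inner) (simp add: power2_eq_square)
  then have "lorentz x x < 0 \<longleftrightarrow> norm (fst x) < \<bar>snd x\<bar>"
    using abs_le_square_iff[of "snd x" "norm (fst x)"] by auto
  then show ?thesis using norm_ge_zero[of "fst x"] unfolding future_def by linarith
qed

lemma lorentz_le_iff_norm: "lorentz x x \<le> 0 \<longleftrightarrow> norm (fst x) \<le> \<bar>snd x\<bar>"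
proof -
  have "lorentz x x = (norm (fst x))\<^sup>2 - (snd x)\<^sup>2"
    by (simp add: lorentz_def power2_norm_eq_inner) (simp add: power2_eq_square)
  then show ?thesis using abs_le_square_iff[of "norm (fst x)" "snd x"] by auto
qed

lemma timelike_snd: "lorentz x x < 0 \<Longrightarrow> snd x \<noteq> 0"
  by (metis diff_zero inner_ge_zero lorentz_def mult_zero_left not_less)

text \<open>Cauchy-Schwarz for the spatial parts, which are dominated by the time coordinates,
  strictly so for \<open>z\<close>.\<close>

lemma lorentz_neg_of_causal:
  assumes "future z" "lorentz x x \<le> 0" "snd x \<ge> 0" "x \<noteq> 0"
  shows "lorentz z x < 0"
proof -
  have x: "norm (fst x) \<le> snd x" using assms by (simp add: lorentz_le_iff_norm)
  have "snd x \<noteq> 0" using x assms(4) by (auto simp: prod_eq_iff)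
  then have "snd x > 0" using assms(3) by simp
  have "fst z \<bullet> fst x \<le> norm (fst z) * norm (fst x)" by (rule norm_cauchy_schwarz)
  also have "\<dots> \<le> norm (fst z) * snd x" using x by (intro mult_left_mono) auto
  also have "\<dots> < snd z * snd x"
    using assms(1) \<open>snd x > 0\<close> by (intro mult_strict_right_mono) (auto simp: future_iff_norm)
  finally show ?thesis by (simp add: lorentz_def)
qed

text \<open>Otherwise \<open>q\<close> or its negative would be a nonzero causal vector with
  nonnegative time coordinate, and its product with \<open>v\<close> would be strictly
  negative.\<close>

lemma spacelike_of_orthogonal:
  assumes "future v" "lorentz q v = 0" "q \<noteq> 0"
  shows "lorentz q q > 0"
proof (rule ccontr)
  assume "\<not> ?thesis"
  then have q: "lorentz q q \<le> 0" by simp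
  show False
  proof (cases "snd q \<ge> 0")
    case True
    then show ?thesis using lorentz_neg_of_causal[OF assms(1) q] assms by (simp add: lorentz_commute)
  next
    case False
    then show ?thesis
      using lorentz_neg_of_causal[OF assms(1), of "- q"] q assms by (simp add: lorentz_simps lorentz_commute)
  qed
qed

text \<open>The radial projection of \<open>future\<close> vectors to hyperbolic space.\<close>

definition nrm :: "'n::finite lspace \<Rightarrow> 'n lspace" where
  "nrm x = (1 / sqrt (- lorentz x x)) *\<^sub>R x"

lemma nrm_hyp_space: "future x \<Longrightarrow> nrm x \<in> hyp_space"
  by (simp add: nrm_def hyp_space_def future_def lorentz_simps flip: power2_eq_square)

lemma nrm_pos: "future x \<Longrightarrow> \<exists>c>0. nrm x = c *\<^sub>R x"
  by (intro exI[of _ "1 / sqrt (- lorentz x x)"]) (simp add: nrm_def future_def)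

lemma hyp_space_eqI:
  assumes "x \<in> hyp_space" "y \<in> hyp_space" "x = c *\<^sub>R y"
  shows "x = y"
proof -
  have "c\<^sup>2 = 1" using assms by (simp add: hyp_space_def lorentz_simps power2_eq_square)
  moreover have "c > 0" using assms by (auto simp: hyp_space_def zero_less_mult_iff)
  ultimately have "c = 1" by (simp add: power2_eq_1_iff)
  then show ?thesis using assms by simp
qed

lemma quadratic_nonneg_leading:
  fixes a b c :: real
  assumes "\<And>t. t \<ge> 0 \<Longrightarrow> a + b * t + c * t\<^sup>2 \<ge> 0"
  shows "c \<ge> 0"
proof (rule ccontr)
  assume "\<not> c \<ge> 0"
  then have c: "c < 0" by simp
  define t where "t = max 1 ((\<bar>a\<bar> + \<bar>b\<bar> + 1) / - c)"
  have t: "t \<ge> 1" by (simp add: t_def)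
  have "(\<bar>a\<bar> + \<bar>b\<bar> + 1) / - c \<le> t" by (simp add: t_def)
  then have ct: "\<bar>a\<bar> + \<bar>b\<bar> + 1 \<le> - (c * t)" using c by (simp only: divide_le_eq) (simp add: mult.commute)
  have "a \<le> \<bar>a\<bar> * t" using t mult_left_mono[of 1 t "\<bar>a\<bar>"] by simp
  moreover have "b * t \<le> \<bar>b\<bar> * t" using t by (intro mult_right_mono) auto
  moreover have "(\<bar>a\<bar> + \<bar>b\<bar> + 1) * t \<le> - (c * t) * t" using ct t by (intro mult_right_mono) auto
  ultimately have "a + b * t + c * t\<^sup>2 \<le> - t" by (simp add: power2_eq_square algebra_simps)
  then show False using assms[of t] t by simp
qed

lemma linear_nonneg_leading:
  fixes a b :: real
  assumes "\<And>t. t \<ge> 0 \<Longrightarrow> a + b * t \<ge> 0"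
  shows "b \<ge> 0"
proof (rule ccontr)
  assume b: "\<not> b \<ge> 0"
  then have "b * ((\<bar>a\<bar> + 1) / - b) = - (\<bar>a\<bar> + 1)" by simp
  then have "a + b * ((\<bar>a\<bar> + 1) / - b) < 0" by linarith
  moreover have "(\<bar>a\<bar> + 1) / - b \<ge> 0" using b by (simp add: divide_nonneg_neg field_simps)
  ultimately show False using assms[of "(\<bar>a\<bar> + 1) / - b"] by linarith
qed

section \<open>Cones over bounded sets of hyperbolic space\<close>

definition lcone :: "'n::finite lspace set \<Rightarrow> 'n lspace set" where
  "lcone A = {x. \<forall>a\<in>A. lorentz a x \<le> 0}"

lemma lcone_dual_cone: "lcone A = dual_cone (flip ` A)"
  by (auto simp: lcone_def dual_cone_def lorentz_flip)

lemma lcone_scale: "c \<ge> 0 \<Longrightarrow> x \<in> lcone A \<Longrightarrow> c *\<^sub>R x \<in> lcone A"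
  by (simp add: lcone_dual_cone dual_cone_scale)

lemma lcone_add: "x \<in> lcone A \<Longrightarrow> y \<in> lcone A \<Longrightarrow> x + y \<in> lcone A"
  by (auto simp: lcone_def lorentz_simps intro: add_nonpos_nonpos)

lemma hyp_bounded_lorentz:
  assumes "hyp_bounded M" "z \<in> M"
  obtains R where "\<And>x. x \<in> M \<Longrightarrow> - lorentz z x \<le> R"
proof -
  obtain r where r: "\<And>x. x \<in> M \<Longrightarrow> arcosh (- lorentz z x) \<le> r"
    using assms by (auto simp: hyp_bounded_def hyp_dist_def)
  \<comment> \<open>Arguments below 1 are split off to remain in the range of the logarithmic
    formula for \<open>arcosh\<close>.\<close>
  have "- lorentz z x \<le> max 1 (exp r)" if "x \<in> M" for x
  proof (cases "- lorentz z x \<ge> 1")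
    case True
    define s where "s = - lorentz z x"
    have "s \<ge> 1" using True by (simp add: s_def)
    then have s: "s \<ge> 1" "s\<^sup>2 \<ge> 1" by (simp_all add: one_le_power)
    have "s \<le> s + sqrt (s\<^sup>2 - 1)" using s by simp
    also have "\<dots> = exp (arcosh s)" using s by (subst arcosh_real_def) (auto simp: add_pos_nonneg)
    also have "\<dots> \<le> exp r" using r[OF that] by (simp add: s_def)
    finally show ?thesis by (simp add: s_def)
  qed simp
  then show ?thesis using that by blast
qed

text \<open>
  A direction \<open>d\<close> of the cone that is not time-like would make the ray from \<open>z\<close> in direction \<open>d\<close>
  approach the light cone, so that its radial projection to hyperbolic space would be unbounded.
\<close>

lemma ray_future:
  assumes bnd: "hyp_bounded (hyp_space \<inter> lcone A)" and z: "z \<in> hyp_space \<inter> lcone A"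
    and d: "d \<in> lcone A" "d \<noteq> 0" and ray: "\<And>t. t \<ge> 0 \<Longrightarrow> z + t *\<^sub>R d \<noteq> 0"
  shows "future d"
proof -
  obtain R where R: "\<And>x. x \<in> hyp_space \<inter> lcone A \<Longrightarrow> - lorentz z x \<le> R"
    using hyp_bounded_lorentz[OF bnd z] by blast
  have fz: "future z" using z by (simp add: future_hyp_space)
  define x where "x t = z + t *\<^sub>R d" for t :: real
  have xK: "x t \<in> lcone A" if "t \<ge> 0" for t
    using z d(1) that by (auto simp: x_def intro!: lcone_add lcone_scale)
  \<comment> \<open>The bound \<open>R\<close> at the radial projection of \<open>x t\<close>,
    squared and cleared of the root: a closed polynomial condition on \<open>t\<close>.\<close>
  have bound: "(lorentz z (x t))\<^sup>2 \<le> R\<^sup>2 * - lorentz (x t) (x t)" if "t \<ge> 0" "future (x t)" for t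
  proof -
    define s where "s = sqrt (- lorentz (x t) (x t))"
    have s: "s > 0" using that by (simp add: s_def future_def)
    have "nrm (x t) \<in> hyp_space \<inter> lcone A"
      using nrm_hyp_space[OF that(2)] nrm_pos[OF that(2)] lcone_scale[OF _ xK[OF that(1)]] by force
    then have "- lorentz z (x t) / s \<le> R" using R[of "nrm (x t)"] by (simp add: nrm_def lorentz_simps s_def)
    then have "- lorentz z (x t) \<le> R * s" using s by (simp only: divide_le_eq if_True)
    moreover have "x t \<noteq> 0" using that by (auto simp: future_def lorentz_simps)
    then have "- lorentz z (x t) \<ge> 0"
      using lorentz_neg_of_causal[OF fz, of "x t"] that by (simp add: future_def)
    ultimately have "(- lorentz z (x t))\<^sup>2 \<le> (R * s)\<^sup>2" by (rule power_mono)
    then show ?thesis using that by (simp add: s_def power_mult_distrib future_def)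
  qed
  \<comment> \<open>Connectedness of the half-line keeps the ray in the future. \<open>U\<close>
    shows that \<open>S\<close> is relatively open, \<open>C\<close> that it is relatively closed: a
    light-like point satisfying the bound would be orthogonal to \<open>z\<close>, which is
    impossible for a nonzero causal vector.\<close>
  define S where "S = {t \<in> {0..}. future (x t)}"
  define U where "U = {t. lorentz (x t) (x t) < 0} \<inter> {t. 0 < snd (x t)}"
  define C where "C = {t. lorentz (x t) (x t) \<le> 0} \<inter> {t. 0 \<le> snd (x t)} \<inter>
    {t. (lorentz z (x t))\<^sup>2 \<le> R\<^sup>2 * - lorentz (x t) (x t)}"
  have "continuous_on UNIV x" unfolding x_def by (intro continuous_intros)
  note cont = continuous_intros this
  have "open U" unfolding U_def by (intro open_Int open_Collect_less cont)
  moreover have SU: "S = {0..} \<inter> U" by (auto simp: S_def U_def future_def)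
  ultimately have opn: "openin (top_of_set {0..}) S" by (simp add: openin_open_Int)
  have "closed C" unfolding C_def by (intro closed_Int closed_Collect_le cont)
  moreover have "S = {0..} \<inter> C"
  proof
    show "S \<subseteq> {0..} \<inter> C" using bound by (auto simp: S_def C_def future_def)
    show "{0..} \<inter> C \<subseteq> S"
    proof
      fix t assume t: "t \<in> {0..} \<inter> C"
      then have "x t \<noteq> 0" using ray by (simp add: x_def)
      then have "lorentz z (x t) < 0" using t by (intro lorentz_neg_of_causal[OF fz]) (auto simp: C_def)
      then have "(lorentz z (x t))\<^sup>2 > 0" by simp
      then have "lorentz (x t) (x t) \<noteq> 0" using t by (auto simp: C_def)
      then have "lorentz (x t) (x t) < 0" using t by (auto simp: C_def)
      moreover from this have "snd (x t) \<noteq> 0" by (rule timelike_snd)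
      ultimately show "t \<in> S" using t by (auto simp: S_def C_def future_def)
    qed
  qed
  ultimately have "closedin (top_of_set {0..}) S" by (simp add: closedin_closed_Int)
  moreover have "connected {0::real..}" by (simp add: is_interval_connected is_interval_ci)
  ultimately have "S = {} \<or> S = {0..}" using opn by (simp add: connected_clopen)
  moreover have "0 \<in> S" using fz by (simp add: S_def x_def)
  ultimately have "S = {0..}" by blast
  then have fut: "future (x t)" if "t \<ge> 0" for t using that by (auto simp: S_def)
  \<comment> \<open>Both sides of \<open>bound\<close> are now quadratic in \<open>t\<close> for all
    nonnegative \<open>t\<close>. Comparing leading coefficients, with \<open>a > 0\<close>, forces
    \<open>c < 0\<close>.\<close>
  define a where "a = - lorentz z d"
  define c where "c = lorentz d d"
  have zz: "lorentz z z = -1" using z by (simp add: hyp_space_def)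
  have xx: "lorentz (x t) (x t) = -1 - 2 * a * t + c * t\<^sup>2" for t
    using zz by (simp add: x_def lorentz_simps a_def c_def lorentz_commute[of d z] power2_eq_square algebra_simps)
  have zx: "lorentz z (x t) = -1 - a * t" for t
    using zz by (simp add: x_def lorentz_simps a_def)
  have "- c \<ge> 0"
  proof (rule quadratic_nonneg_leading)
    fix t :: real assume "t \<ge> 0"
    then show "1 + (2 * a) * t + (- c) * t\<^sup>2 \<ge> 0" using fut[of t] xx[of t] by (simp add: future_def)
  qed
  moreover have "snd d \<ge> 0"
  proof (rule linear_nonneg_leading)
    fix t :: real assume "t \<ge> 0"
    then show "snd z + snd d * t \<ge> 0" using fut[of t] by (simp add: future_def x_def mult.commute)
  qed
  ultimately have "a > 0" using lorentz_neg_of_causal[OF fz _ _ d(2)] by (simp add: a_def c_def)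
  have "R\<^sup>2 * (- c) - a\<^sup>2 \<ge> 0"
  proof (rule quadratic_nonneg_leading)
    fix t :: real assume "t \<ge> 0"
    then show "(R\<^sup>2 - 1) + (R\<^sup>2 * (2 * a) - 2 * a) * t + (R\<^sup>2 * (- c) - a\<^sup>2) * t\<^sup>2 \<ge> 0"
      using bound[OF _ fut, of t] by (simp add: xx zx power2_eq_square algebra_simps)
  qed
  then have "R\<^sup>2 * c < 0" using \<open>a > 0\<close> zero_less_power[of a 2] by linarith
  then have "c < 0" by (simp add: mult_less_0_iff)
  moreover from this have "snd d \<noteq> 0" unfolding c_def by (rule timelike_snd)
  ultimately show ?thesis using \<open>snd d \<ge> 0\<close> by (simp add: future_def c_def)
qed

text \<open>A constraint that is strict at \<open>z\<close> stays strict along the ray, so the ray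
  avoids the origin and \<open>ray_future\<close> applies.\<close>

lemma lcone_future:
  fixes A :: "'n::finite lspace set"
  assumes bnd: "hyp_bounded (hyp_space \<inter> lcone A)" and z: "z \<in> hyp_space"
    and strict: "\<And>a. a \<in> A \<Longrightarrow> lorentz a z < 0"
    and d: "d \<in> lcone A" "d \<noteq> 0"
  shows "future d"
proof -
  have zM: "z \<in> hyp_space \<inter> lcone A" using z strict by (auto simp: lcone_def less_imp_le)
  have "A \<noteq> {}"
  proof
    assume A: "A = {}"
    \<comment> \<open>Without constraints every direction lies in the cone, in particular this
      space-like one.\<close>
    define e :: "'n lspace" where "e = (1, 0)"
    have "(1 :: real ^ 'n) \<noteq> 0" by (simp add: vec_eq_iff)
    then have "e \<noteq> 0" by (simp add: e_def prod_eq_iff)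
    moreover have "z + t *\<^sub>R e \<noteq> 0" for t using z by (auto simp: hyp_space_def e_def prod_eq_iff)
    ultimately have "future e" using A by (intro ray_future[OF bnd zM]) (auto simp: lcone_def)
    then show False by (simp add: future_def e_def)
  qed
  then obtain a where a: "a \<in> A" by blast
  show ?thesis
  proof (rule ray_future[OF bnd zM d])
    fix t :: real assume t: "t \<ge> 0"
    have "lorentz a (z + t *\<^sub>R d) < 0"
      using strict[OF a] d(1) a t by (auto simp: lcone_def lorentz_simps intro!: add_neg_nonpos mult_nonneg_nonpos)
    then show "z + t *\<^sub>R d \<noteq> 0" by (metis less_irrefl lorentz_simps(10))
  qed
qed

text \<open>By nondegeneracy of the form, \<open>c\<close> is a multiple of \<open>a\<close>; the
  unit norms leave only the sign.\<close>

lemma parallel_of_orthogonal: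
  assumes "a \<in> de_sitter" "c \<in> de_sitter" "\<And>x. lorentz a x = 0 \<Longrightarrow> lorentz c x = 0"
  shows "c = a \<or> c = - a"
proof -
  have aa: "lorentz a a = 1" using assms(1) by (simp add: de_sitter_def)
  define e where "e = c - lorentz c a *\<^sub>R a"
  have "lorentz e x = 0" for x
  proof -
    have "lorentz a (x - lorentz a x *\<^sub>R a) = 0" using aa by (simp add: lorentz_simps)
    then have "lorentz c (x - lorentz a x *\<^sub>R a) = 0" by (rule assms(3))
    then show ?thesis by (simp add: e_def lorentz_simps mult.commute)
  qed
  from this[of "flip e"] have "e = 0" by (metis lorentz_flip flip_flip inner_eq_zero_iff linear_flip linear_0)
  then have c: "c = lorentz c a *\<^sub>R a" by (simp add: e_def)
  then have "lorentz c c = (lorentz c a)\<^sup>2 * lorentz a a"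
    by (metis lorentz_simps(5,6) mult.assoc power2_eq_square)
  then have "(lorentz c a)\<^sup>2 = 1" using aa assms(2) by (simp add: de_sitter_def)
  then have "lorentz c a = 1 \<or> lorentz c a = -1" by (simp add: power2_eq_1_iff)
  then show ?thesis using c by (metis scaleR_one scaleR_minus1_left)
qed

subsection \<open>Hyperbolic polytopes as simple cones\<close>

text \<open>A polytope given by an irredundant set of half-spaces, with an interior point
  \<open>z\<close>. Irredundancy makes the normals in \<open>A\<close> correspond bijectively to the
  facets.\<close>

locale hyp_cone =
  fixes A :: "'n::finite lspace set" and z :: "'n lspace"
  assumes finite_A: "finite A"
    and A_sitter: "A \<subseteq> de_sitter"
    and card_n: "CARD('n) \<ge> 3"
    and bounded: "hyp_bounded (hyp_space \<inter> lcone A)"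
    and z: "z \<in> hyp_space"
    and interior: "\<And>a. a \<in> A \<Longrightarrow> lorentz a z < 0"
    and irredundant: "\<And>a. a \<in> A \<Longrightarrow> \<exists>x. lorentz a x > 0 \<and> (\<forall>b\<in>A - {a}. lorentz b x \<le> 0)"
begin

abbreviation "M \<equiv> hyp_space \<inter> lcone A"

definition ker :: "'n lspace set \<Rightarrow> 'n lspace set" where
  "ker B = {x. \<forall>b\<in>B. lorentz b x = 0}"

lemma lcone_future': "x \<in> lcone A \<Longrightarrow> x \<noteq> 0 \<Longrightarrow> future x"
  using lcone_future[OF bounded z interior] by blast

lemma nrm_M: "x \<in> lcone A \<Longrightarrow> x \<noteq> 0 \<Longrightarrow> nrm x \<in> M"
  using lcone_future'[of x] nrm_hyp_space[of x] nrm_pos[of x] lcone_scale[of _ x A] by force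

lemma hyp_space_nonzero: "x \<in> hyp_space \<Longrightarrow> x \<noteq> 0"
  by (auto simp: hyp_space_def)

lemma subspace_ker: "subspace (ker B)"
  by (auto simp: subspace_def ker_def lorentz_simps)

lemma dim_ker:
  assumes "finite B" "independent (flip ` B)"
  shows "dim (ker B) + card B = CARD('n) + 1"
proof -
  have "{y \<in> UNIV. \<forall>x\<in>span (flip ` B). orthogonal x y} = ker B"
  proof
    show "{y \<in> UNIV. \<forall>x\<in>span (flip ` B). orthogonal x y} \<subseteq> ker B"
      by (auto simp: ker_def lorentz_flip orthogonal_def span_base)
    show "ker B \<subseteq> {y \<in> UNIV. \<forall>x\<in>span (flip ` B). orthogonal x y}"
    proof clarsimp
      fix y x assume y: "y \<in> ker B" and x: "x \<in> span (flip ` B)"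
      have "orthogonal y x"
        using x by (rule orthogonal_to_span) (use y in \<open>auto simp: ker_def lorentz_flip orthogonal_def inner_commute\<close>)
      then show "orthogonal x y" by (simp add: orthogonal_commute)
    qed
  qed
  moreover have "dim {y \<in> UNIV. \<forall>x\<in>span (flip ` B). orthogonal x y} + dim (span (flip ` B))
      = dim (UNIV :: 'n lspace set)"
    by (rule dim_subspace_orthogonal_to_vectors) auto
  moreover have "dim (flip ` B) = card B"
    using dim_eq_card_independent[OF assms(2)] by (simp add: card_image[OF inj_flip])
  ultimately show ?thesis by simp
qed

text \<open>The point \<open>y\<close> is relatively interior to the face, so a small step from
  \<open>y\<close> in any direction of \<open>ker B\<close> stays in the cone, and differences of
  such points fill \<open>ker B\<close>.\<close>

lemma span_face:
  assumes "B \<subseteq> A" and y: "y \<in> ker B" "\<And>a. a \<in> A - B \<Longrightarrow> lorentz a y < 0"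
  shows "span (M \<inter> ker B) = ker B"
proof
  show "span (M \<inter> ker B) \<subseteq> ker B" by (rule span_minimal) (auto simp: subspace_ker)
  have in_span: "x \<in> span (M \<inter> ker B)" if x: "x \<in> ker B" "x \<in> lcone A" for x
  proof (cases "x = 0")
    case False
    have fx: "future x" using lcone_future' x False by blast
    obtain c where c: "c > 0" "nrm x = c *\<^sub>R x" using nrm_pos[OF fx] by blast
    have "nrm x \<in> M \<inter> ker B"
      using nrm_M[OF x(2) False] x(1) c by (auto intro: subspace_scale[OF subspace_ker])
    then have "(1 / c) *\<^sub>R nrm x \<in> span (M \<inter> ker B)" by (intro span_scale span_base)
    then show ?thesis using c by simp
  qed (simp add: span_zero)
  show "ker B \<subseteq> span (M \<inter> ker B)"
  proof
    fix d assume d: "d \<in> ker B"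
    have "\<exists>e>0. \<forall>p\<in>flip ` (A - B). p \<bullet> (y + e *\<^sub>R d) < 0"
      by (rule finite_strict_step) (use finite_A y(2) in \<open>force simp: lorentz_flip\<close>)+
    then obtain e where e: "e > 0" "\<And>p. p \<in> flip ` (A - B) \<Longrightarrow> p \<bullet> (y + e *\<^sub>R d) < 0" by blast
    have yd: "y + e *\<^sub>R d \<in> ker B"
      using y(1) d by (intro subspace_add[OF subspace_ker] subspace_scale[OF subspace_ker])
    have "lorentz a (y + e *\<^sub>R d) \<le> 0" if "a \<in> A" for a
      using that e(2)[of "flip a"] yd by (cases "a \<in> B") (auto simp: ker_def lorentz_flip less_imp_le)
    then have "y + e *\<^sub>R d \<in> span (M \<inter> ker B)" using yd by (intro in_span) (auto simp: lcone_def)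
    moreover have "lorentz a y \<le> 0" if "a \<in> A" for a
      using that y by (cases "a \<in> B") (auto simp: ker_def less_imp_le)
    then have "y \<in> span (M \<inter> ker B)" using y(1) by (intro in_span) (auto simp: lcone_def)
    ultimately have "(y + e *\<^sub>R d) - y \<in> span (M \<inter> ker B)" by (rule span_diff)
    then have "(1 / e) *\<^sub>R ((y + e *\<^sub>R d) - y) \<in> span (M \<inter> ker B)" by (rule span_scale)
    then show "d \<in> span (M \<inter> ker B)" using e(1) by simp
  qed
qed

lemma sitter_nonzero: "a \<in> de_sitter \<Longrightarrow> a \<noteq> 0"
  by (auto simp: de_sitter_def lorentz_simps)

lemma dim_ker_singleton:
  assumes "a \<in> de_sitter"
  shows "dim (ker {a}) = CARD('n)"
proof -
  have "flip a \<noteq> 0" using sitter_nonzero[OF assms] by (metis flip_flip linear_0 linear_flip)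
  then show ?thesis using dim_ker[of "{a}"] by (simp add: independent_insert)
qed

definition facet :: "'n lspace \<Rightarrow> 'n lspace set" where
  "facet a = M \<inter> hyp_hyperplane a"

lemma facet_eq: "facet a = M \<inter> ker {a}"
  by (auto simp: facet_def hyp_hyperplane_def ker_def)

lemma span_facet:
  assumes "a \<in> A"
  shows "span (facet a) = ker {a}"
proof -
  obtain x where x: "lorentz a x > 0" "\<And>b. b \<in> A - {a} \<Longrightarrow> lorentz b x \<le> 0"
    using irredundant[OF assms] by blast
  \<comment> \<open>Up to scaling, the point where the segment from the interior point
    \<open>z\<close> to \<open>x\<close>, which violates only \<open>a\<close>, crosses the wall of
    \<open>a\<close>.\<close>
  define y where "y = lorentz a x *\<^sub>R z - lorentz a z *\<^sub>R x"
  have "lorentz b y < 0" if "b \<in> A - {a}" for b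
    using x(1) x(2)[OF that] interior[OF assms] interior[of b] that
    by (auto simp: y_def lorentz_simps intro!: add_neg_nonpos mult_pos_neg mult_nonpos_nonpos)
      (smt (verit) mult_nonpos_nonpos mult_pos_neg)
  moreover have "y \<in> ker {a}" by (simp add: y_def ker_def lorentz_simps)
  ultimately show ?thesis unfolding facet_eq using assms by (intro span_face[where y = y]) auto
qed

lemma facet_in_facets:
  assumes "a \<in> A"
  shows "facet a \<in> hyp_facets M"
proof -
  have "dim (facet a) = CARD('n)"
    using dim_ker_singleton[of a] A_sitter assms span_facet[OF assms] dim_span[of "facet a"] by auto
  moreover have "M \<subseteq> hyp_halfspace a" using assms by (auto simp: hyp_halfspace_def lcone_def)
  ultimately show ?thesis
    using assms A_sitter by (auto simp: hyp_facets_def hyp_face_def facet_def hyp_dim_def)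
qed

lemma facet_inj:
  assumes "a \<in> A" "b \<in> A" "facet a = facet b"
  shows "a = b"
proof -
  have "ker {a} = ker {b}" using span_facet assms by metis
  then have "b = a \<or> b = - a"
    using A_sitter assms by (intro parallel_of_orthogonal) (auto simp: ker_def)
  then show ?thesis using interior[of a] interior[of b] assms by (auto simp: lorentz_simps)
qed

lemma dim_M: "dim M = CARD('n) + 1"
proof -
  have "span (M \<inter> ker {}) = ker {}"
    using interior by (intro span_face[where y = z]) (auto simp: ker_def)
  then have "span M = UNIV" by (simp add: ker_def)
  then show ?thesis using dim_span[of M] by simp
qed

text \<open>Let \<open>y\<close> be the sum of a basis of the face. If \<open>y\<close> were strict
  for all of \<open>A\<close>, a step in direction \<open>q\<close> would stay in the cone and
  violate the supporting half-space of \<open>q\<close>. So some \<open>a\<close> vanishes at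
  \<open>y\<close>, hence on the whole basis, and comparing dimensions identifies the two
  hyperplanes.\<close>

lemma facets_are_facet:
  assumes "F \<in> hyp_facets M"
  obtains a where "a \<in> A" "F = facet a"
proof -
  have dimF: "dim F = CARD('n)" using assms by (simp add: hyp_facets_def hyp_dim_def)
  then have "F \<noteq> M" using dim_M by auto
  then obtain q where q: "q \<in> de_sitter" "M \<subseteq> hyp_halfspace q" "F = M \<inter> hyp_hyperplane q"
    using assms by (auto simp: hyp_facets_def hyp_face_def)
  have q_le: "lorentz q x \<le> 0" if x: "x \<in> lcone A" for x
  proof (cases "x = 0")
    case False
    then have "nrm x \<in> M" using nrm_M x by blast
    then have "lorentz q (nrm x) \<le> 0" using q(2) by (auto simp: hyp_halfspace_def)
    moreover obtain c where "c > 0" "nrm x = c *\<^sub>R x"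
      using nrm_pos[OF lcone_future'[OF x False]] by blast
    ultimately show ?thesis by (simp add: lorentz_simps mult_le_0_iff)
  qed (simp add: lorentz_simps)
  obtain Bs where Bs: "Bs \<subseteq> F" "independent Bs" "F \<subseteq> span Bs" "card Bs = dim F"
    using basis_exists[of F] by blast
  have finBs: "finite Bs" using Bs(2) independent_imp_finite by blast
  define y where "y = \<Sum>Bs"
  have qy: "lorentz q y = 0"
    using Bs(1) q(3) by (auto simp: y_def lorentz_sum_right hyp_hyperplane_def intro!: sum.neutral)
  have le: "lorentz a x \<le> 0" if "a \<in> A" "x \<in> Bs" for a x
    using that Bs(1) q(3) by (auto simp: lcone_def)
  have "\<exists>a\<in>A. lorentz a y \<ge> 0"
  proof (rule ccontr)
    assume "\<not> ?thesis"
    then obtain e where e: "e > 0" "\<And>p. p \<in> flip ` A \<Longrightarrow> p \<bullet> (y + e *\<^sub>R q) < 0"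
      using finite_strict_step[of "flip ` A" y q] finite_A by (force simp: lorentz_flip)
    then have "y + e *\<^sub>R q \<in> lcone A" by (auto simp: lcone_def lorentz_flip less_imp_le)
    then have "lorentz q (y + e *\<^sub>R q) \<le> 0" by (rule q_le)
    then show False using qy q(1) e(1) by (simp add: lorentz_simps de_sitter_def)
  qed
  then obtain a where a: "a \<in> A" "lorentz a y \<ge> 0" by blast
  have "(\<Sum>x\<in>Bs. lorentz a x) \<le> 0" using le[OF a(1)] by (intro sum_nonpos) auto
  then have "(\<Sum>x\<in>Bs. - lorentz a x) = 0" using a(2) by (simp add: y_def lorentz_sum_right sum_negf)
  then have "Bs \<subseteq> ker {a}" using le[OF a(1)] finBs by (auto simp: sum_nonneg_eq_0_iff ker_def)
  then have "span Bs \<subseteq> ker {a}" by (rule span_minimal) (rule subspace_ker)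
  moreover have "a \<in> de_sitter" using a A_sitter by auto
  moreover have "dim (span Bs) = CARD('n)" using Bs dimF by (simp add: dim_eq_card_independent)
  ultimately have "span Bs = ker {a}"
    using dim_ker_singleton[of a] by (intro subspace_dim_equal) (auto simp: subspace_ker)
  moreover have "span Bs \<subseteq> ker {q}"
    using Bs(1) q(3) by (intro span_minimal subspace_ker) (auto simp: ker_def hyp_hyperplane_def)
  ultimately have "q = a \<or> q = - a"
    using \<open>a \<in> de_sitter\<close> q(1) by (intro parallel_of_orthogonal) (auto simp: ker_def)
  then have "F = facet a" by (auto simp: q(3) facet_def hyp_hyperplane_def lorentz_simps)
  then show ?thesis using that a(1) by blast
qed

text \<open>The sum of the normals in \<open>B\<close> supports the polytope exactly where all of
  them vanish. It is orthogonal to the time-like \<open>v\<close> and nonzero by its value at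
  \<open>z\<close>, hence space-like, and can be normalized to lie in
  \<open>de_sitter\<close>.\<close>

lemma hyp_face_ker:
  assumes "B \<subseteq> A" "B \<noteq> {}" "v \<in> M" "v \<in> ker B"
  shows "hyp_face (M \<inter> ker B) M"
proof -
  have finB: "finite B" using assms(1) finite_A finite_subset by blast
  define q where "q = \<Sum>B"
  have "lorentz q z < 0"
    using sum_strict_mono[OF finB assms(2), of "\<lambda>b. lorentz b z" "\<lambda>_. 0"] assms(1) interior
    by (auto simp: q_def lorentz_sum_left)
  then have "q \<noteq> 0" by (auto simp: lorentz_simps)
  moreover have "lorentz q v = 0" using assms(4) by (simp add: q_def lorentz_sum_left ker_def)
  ultimately have qq: "lorentz q q > 0"
    using assms(3) by (intro spacelike_of_orthogonal[OF future_hyp_space]) auto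
  define p where "p = (1 / sqrt (lorentz q q)) *\<^sub>R q"
  have p: "p \<in> de_sitter" using qq by (simp add: p_def de_sitter_def lorentz_simps flip: power2_eq_square)
  have pq: "lorentz p x = lorentz q x / sqrt (lorentz q q)" for x by (simp add: p_def lorentz_simps)
  have le: "lorentz b x \<le> 0" if "b \<in> B" "x \<in> M" for b x using that assms(1) by (auto simp: lcone_def)
  have "M \<subseteq> hyp_halfspace p"
  proof
    fix x assume x: "x \<in> M"
    then have "lorentz q x \<le> 0" using le by (simp add: q_def lorentz_sum_left sum_nonpos)
    then show "x \<in> hyp_halfspace p" using x qq by (simp add: hyp_halfspace_def pq divide_le_0_iff)
  qed
  moreover have "lorentz p x = 0 \<longleftrightarrow> x \<in> ker B" if x: "x \<in> M" for x
  proof -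
    have "lorentz p x = 0 \<longleftrightarrow> (\<Sum>b\<in>B. - lorentz b x) = 0"
      using qq by (simp add: pq) (simp add: q_def lorentz_sum_left sum_negf)
    also have "\<dots> \<longleftrightarrow> x \<in> ker B" using le[OF _ x] finB by (simp add: sum_nonneg_eq_0_iff ker_def)
    finally show ?thesis .
  qed
  then have "M \<inter> ker B = M \<inter> hyp_hyperplane p" by (auto simp: hyp_hyperplane_def)
  ultimately show ?thesis using p by (auto simp: hyp_face_def)
qed

text \<open>The radial projection of an extreme ray is a vertex of the polytope, and its tight
  normals are those of the facets through that vertex. The count \<open>CARD('n)\<close> there is
  one less than the dimension of the ambient space.\<close>

lemma simple_cone_flip:
  assumes "simple_polytope M"
  shows "simple_cone (flip ` A) (- flip z)"
proof
  show "finite (flip ` A)" using finite_A by simp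
  show "- flip z \<bullet> x > 0" if "x \<in> dual_cone (flip ` A)" "x \<noteq> 0" for x
    using lcone_future'[of x] lorentz_neg_of_causal[OF future_hyp_space[OF z], of x] that
    by (simp add: lcone_dual_cone future_def flip: lorentz_flip)
  fix v assume v: "v \<in> cone_vertices (flip ` A) (- flip z)"
  then have vK: "v \<in> lcone A" "v \<noteq> 0"
    by (auto simp: cone_vertices_def lcone_dual_cone)
  have fv: "future v" using lcone_future'[OF vK] .
  obtain c where c: "c > 0" "nrm v = c *\<^sub>R v" using nrm_pos[OF fv] by blast
  define B where "B = {a \<in> A. lorentz a v = 0}"
  have tB: "tight (flip ` A) v = flip ` B" by (auto simp: tight_def B_def lorentz_flip)
  have kerB: "x \<in> span {v}" if "x \<in> ker B" for x
    using v that by (simp add: cone_vertices_def tB ker_def lorentz_flip del: split_paired_All)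
  have "B \<noteq> {}"
  proof
    assume "B = {}"
    then have "span {v} = UNIV" using kerB by (auto simp: ker_def)
    then have "dim (span {v}) = CARD('n) + 1" by simp
    then show False using card_n vK(2) by (simp add: dim_singleton)
  qed
  have nK: "nrm v \<in> M" using nrm_M[OF vK] .
  have vB: "nrm v \<in> ker B" by (auto simp: ker_def B_def c(2) lorentz_simps)
  have "M \<inter> ker B = {nrm v}"
  proof
    show "M \<inter> ker B \<subseteq> {nrm v}"
    proof
      fix x assume x: "x \<in> M \<inter> ker B"
      then obtain k where "x = k *\<^sub>R v" using kerB[of x] by (auto simp: span_singleton)
      then have eq: "x = (k / c) *\<^sub>R nrm v" using c by simp
      have "x = nrm v" by (rule hyp_space_eqI[OF _ _ eq]) (use x nK in blast)+
      then show "x \<in> {nrm v}" by simp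
    qed
  qed (use nK vB in auto)
  then have "hyp_face {nrm v} M"
    using hyp_face_ker[of B "nrm v"] \<open>B \<noteq> {}\<close> nK vB by (auto simp: B_def)
  then have "nrm v \<in> hyp_vertices M" by (simp add: hyp_vertices_def)
  then have "card {F \<in> hyp_facets M. nrm v \<in> F} = CARD('n)"
    using assms unfolding simple_polytope_def by blast
  moreover have "{F \<in> hyp_facets M. nrm v \<in> F} = facet ` B"
  proof
    show "{F \<in> hyp_facets M. nrm v \<in> F} \<subseteq> facet ` B"
    proof
      fix F assume F: "F \<in> {F \<in> hyp_facets M. nrm v \<in> F}"
      then obtain a where a: "a \<in> A" "F = facet a" using facets_are_facet[of F] by blast
      then have "lorentz a v = 0" using F c by (auto simp: facet_def hyp_hyperplane_def lorentz_simps)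
      then show "F \<in> facet ` B" using a by (auto simp: B_def)
    qed
    show "facet ` B \<subseteq> {F \<in> hyp_facets M. nrm v \<in> F}"
      using facet_in_facets nK vB by (auto simp: B_def facet_eq ker_def)
  qed
  moreover have "inj_on facet B" using facet_inj by (auto simp: B_def intro!: inj_onI)
  ultimately show "card (tight (flip ` A) v) = DIM('n lspace) - 1"
    by (simp add: tB card_image[OF inj_flip] card_image)
qed

text \<open>Simplicity makes the normals at \<open>v\<close> independent and provides an edge for
  each of them, hence a relatively interior point of the common face, whose dimension
  \<open>span_face\<close> and \<open>dim_ker\<close> then determine.\<close>

lemma adjacent_facets_at_vertex:
  assumes simpl: "simple_polytope M" and v: "v \<in> cone_vertices (flip ` A) (- flip z)"
    and ab: "a \<in> A" "b \<in> A" "a \<noteq> b" "lorentz a v = 0" "lorentz b v = 0"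
  shows "adjacent_facets M (facet a) (facet b)"
proof -
  interpret simple_cone "flip ` A" "- flip z" by (rule simple_cone_flip[OF simpl])
  have vK: "v \<in> lcone A" "v \<noteq> 0" using v vertex_nonzero[OF v] by (auto simp: cone_vertices_def lcone_dual_cone)
  have nK: "nrm v \<in> M" using nrm_M[OF vK] .
  have T: "flip a \<in> T v" "flip b \<in> T v" using ab by (auto simp: tight_def lorentz_flip)
  have inter: "facet a \<inter> facet b = M \<inter> ker {a, b}" by (auto simp: facet_eq ker_def)
  obtain c where "nrm v = c *\<^sub>R v" using nrm_pos[OF lcone_future'[OF vK]] by blast
  then have "nrm v \<in> ker {a, b}" using ab by (simp add: ker_def lorentz_simps)
  then have face: "hyp_face (facet a \<inter> facet b) M"
    unfolding inter using ab nK by (intro hyp_face_ker) auto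
  have "\<exists>w. w \<in> X \<and> w \<noteq> v \<and> T v - {i} \<subseteq> T w" if "i \<in> T v" for i
    using edge_exists[OF v that] by metis
  then obtain nb where nb: "\<And>i. i \<in> T v \<Longrightarrow> nb i \<in> X \<and> nb i \<noteq> v \<and> T v - {i} \<subseteq> T (nb i)"
    by metis
  \<comment> \<open>The edges leaving the facets in \<open>S\<close> stay in both \<open>a\<close>
    and \<open>b\<close>. In the sum \<open>y\<close>, a constraint tight at \<open>v\<close> is
    made strict by the neighbour across its own edge, any other constraint by \<open>v\<close>
    itself.\<close>
  define S where "S = T v - {flip a, flip b}"
  define y where "y = v + (\<Sum>i\<in>S. nb i)"
  have finS: "finite S" using finite_T by (simp add: S_def)
  have nonpos: "p \<bullet> nb i \<le> 0" if "p \<in> flip ` A" "i \<in> S" for p i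
    using nb[of i] vertex_nonpos[of "nb i" p] that by (auto simp: S_def)
  have "p \<bullet> nb i = 0" if "p \<in> {flip a, flip b}" "i \<in> S" for p i
    using nb[of i] that T by (auto simp: S_def tight_def)
  then have "p \<bullet> y = 0" if "p \<in> {flip a, flip b}" for p
    using that T by (auto simp: y_def inner_add_right inner_sum_right tight_def)
  then have ker_y: "y \<in> ker {a, b}" by (auto simp: ker_def lorentz_flip)
  have "lorentz q y < 0" if q: "q \<in> A - {a, b}" for q
  proof -
    define p where "p = flip q"
    have p: "p \<in> flip ` A" "p \<notin> {flip a, flip b}" using q by (auto simp: p_def dest: injD[OF inj_flip])
    have sum: "(\<Sum>i\<in>S'. p \<bullet> nb i) \<le> 0" if "S' \<subseteq> S" for S'
      using nonpos[OF p(1)] that by (intro sum_nonpos) auto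
    have "p \<bullet> v + (\<Sum>i\<in>S. p \<bullet> nb i) < 0"
    proof (cases "p \<in> T v")
      case True
      then have pS: "p \<in> S" using p by (simp add: S_def)
      have "p \<bullet> nb p < 0" using edge_strict[OF v _ _ True] nb[OF True] by blast
      then have "(\<Sum>i\<in>S. p \<bullet> nb i) < 0"
        using sum[of "S - {p}"] sum.remove[OF finS pS, of "\<lambda>i. p \<bullet> nb i"] by auto
      then show ?thesis using True by (simp add: tight_def)
    next
      case False
      then have "p \<bullet> v < 0" using vertex_nonpos[OF v p(1)] p(1) by (auto simp: tight_def)
      then show ?thesis using sum[of S] by simp
    qed
    then show ?thesis by (simp add: lorentz_flip y_def p_def inner_add_right inner_sum_right)
  qed
  then have "span (M \<inter> ker {a, b}) = ker {a, b}"
    using ab ker_y by (intro span_face[where y = y]) auto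
  then have "dim (M \<inter> ker {a, b}) = dim (ker {a, b})" by (metis dim_span)
  moreover have "independent (flip ` {a, b})"
    by (rule independent_mono[OF vertex_independent[OF v]]) (use T in auto)
  then have "dim (ker {a, b}) + 2 = CARD('n) + 1" using dim_ker[of "{a, b}"] ab(3) by simp
  ultimately have "hyp_dim (facet a \<inter> facet b) = int CARD('n) - 2" by (simp add: hyp_dim_def inter)
  moreover have "facet a \<noteq> facet b" using facet_inj ab by blast
  ultimately show ?thesis
    using face facet_in_facets ab by (simp add: adjacent_facets_def)
qed

lemma normal_eq:
  assumes p: "facet_normals M p" and a: "a \<in> A"
  shows "p (facet a) = a \<or> p (facet a) = - a"
proof (rule parallel_of_orthogonal)
  have F: "facet a \<in> hyp_facets M" by (rule facet_in_facets[OF a])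
  show "a \<in> de_sitter" using a A_sitter by auto
  show "p (facet a) \<in> de_sitter" using p F by (simp add: facet_normals_def)
  have "facet a \<subseteq> hyp_span (facet a)"
    by (auto simp: hyp_span_def span_base facet_def)
  then have "facet a \<subseteq> ker {p (facet a)}"
    using p F by (auto simp: facet_normals_def hyp_hyperplane_def ker_def)
  then have "span (facet a) \<subseteq> ker {p (facet a)}" by (rule span_minimal) (rule subspace_ker)
  then have "ker {a} \<subseteq> ker {p (facet a)}" by (simp add: span_facet[OF a])
  then show "lorentz (p (facet a)) x = 0" if "lorentz a x = 0" for x
    using that by (auto simp: ker_def)
qed

lemma stiff_M:
  assumes simpl: "simple_polytope M"
  shows "stiff M"
  unfolding stiff_def
proof (intro allI impI)
  fix p u assume p: "facet_normals M p" and u: "first_order_motion M p u"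
  interpret simple_cone "flip ` A" "- flip z" by (rule simple_cone_flip[OF simpl])
  \<comment> \<open>The sign by which the prescribed normal differs from the one in
    \<open>A\<close>. Multiplying the motion by the same sign in \<open>u'\<close> preserves the
    conditions, since signs square to 1.\<close>
  define k where "k a = lorentz (p (facet a)) a" for a
  have k: "p (facet a) = k a *\<^sub>R a" "k a * k a = 1" if a: "a \<in> A" for a
  proof -
    have "lorentz a a = 1" using a A_sitter by (auto simp: de_sitter_def)
    then have "k a = 1 \<and> p (facet a) = a \<or> k a = -1 \<and> p (facet a) = - a"
      using normal_eq[OF p a] by (elim disjE) (simp_all add: k_def lorentz_simps)
    then show "p (facet a) = k a *\<^sub>R a" "k a * k a = 1" by (elim disjE; simp)+
  qed
  define u' where "u' q = k (flip q) *\<^sub>R u (facet (flip q))" for q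
  have mot: "lorentz a (k b *\<^sub>R u (facet b)) + lorentz b (k a *\<^sub>R u (facet a)) = 0"
    if v: "v \<in> X" and ab: "a \<in> A" "b \<in> A" "lorentz a v = 0" "lorentz b v = 0" for v a b
  proof (cases "a = b")
    case True
    have "lorentz (p (facet a)) (u (facet a)) = 0"
      using u facet_in_facets[OF ab(1)] by (simp add: first_order_motion_def)
    then show ?thesis using True k(1)[OF ab(1)] by (simp add: lorentz_simps)
  next
    case False
    have "lorentz (p (facet a)) (u (facet b)) + lorentz (p (facet b)) (u (facet a)) = 0"
      using u adjacent_facets_at_vertex[OF simpl v ab(1,2) False ab(3,4)]
      by (simp add: first_order_motion_def)
    then have "k a * lorentz a (u (facet b)) + k b * lorentz b (u (facet a)) = 0"
      by (simp add: k(1)[OF ab(1)] k(1)[OF ab(2)] lorentz_simps)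
    then have "k a * k b * (k a * lorentz a (u (facet b)) + k b * lorentz b (u (facet a))) = 0" by simp
    then have "(k a * k a) * (k b * lorentz a (u (facet b))) + (k b * k b) * (k a * lorentz b (u (facet a))) = 0"
      by (simp add: algebra_simps)
    then show ?thesis by (simp add: k(2)[OF ab(1)] k(2)[OF ab(2)] lorentz_simps)
  qed
  have mot': "motion u'"
    unfolding motion_def
  proof (intro ballI)
    fix v q r assume v: "v \<in> X" and "q \<in> T v" "r \<in> T v"
    then obtain a b where "a \<in> A" "b \<in> A" "lorentz a v = 0" "lorentz b v = 0" "q = flip a" "r = flip b"
      by (auto simp: tight_def lorentz_flip)
    then show "q \<bullet> u' r + r \<bullet> u' q = 0" using mot[OF v, of a b] by (simp add: u'_def lorentz_flip)
  qed
  have nonempty: "\<exists>x\<in>K. x \<noteq> 0 \<and> q \<bullet> x = 0" if "q \<in> flip ` A" for q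
  proof -
    obtain a where a: "a \<in> A" "q = flip a" using \<open>q \<in> flip ` A\<close> by blast
    \<comment> \<open>The empty set has dimension zero, while a facet spans a space of dimension
      \<open>CARD('n)\<close>.\<close>
    have "facet a \<noteq> {}"
    proof
      assume "facet a = {}"
      moreover have "dim (facet a) = CARD('n)"
        using facet_in_facets[OF a(1)] by (simp add: hyp_facets_def hyp_dim_def)
      ultimately show False using card_n by simp
    qed
    then obtain x where "x \<in> facet a" by blast
    then show ?thesis using a
      by (intro bexI[of _ x]) (auto simp: facet_def hyp_hyperplane_def hyp_space_nonzero lcone_dual_cone lorentz_flip)
  qed
  have dim: "DIM('n lspace) \<ge> 4" using card_n by simp
  obtain W where W: "linear W" "\<And>x y. x \<bullet> W y + y \<bullet> W x = 0"
      "\<And>q. q \<in> flip ` A \<Longrightarrow> u' q = W q"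
    using infinitesimal_rigidity[OF dim mot' nonempty] by blast
  \<comment> \<open>Composing with \<open>flip\<close> turns skewness for the Euclidean product into
    skewness for the Lorentz form.\<close>
  define w where "w x = W (flip x)" for x
  have skew: "lorentz x (w y) + lorentz y (w x) = 0" for x y
    using W(2) by (simp add: lorentz_flip w_def)
  have "lorentz x (w x) = 0" for x using skew[of x x] by simp
  with skew have "trivial_motion w" by (simp add: trivial_motion_def)
  moreover have "u F = w (p F)" if F: "F \<in> hyp_facets M" for F
  proof -
    obtain a where a: "a \<in> A" "F = facet a" using facets_are_facet[OF F] by blast
    have "k a *\<^sub>R u F = W (flip a)" using W(3)[of "flip a"] a by (simp add: u'_def)
    then have "(k a * k a) *\<^sub>R u F = k a *\<^sub>R W (flip a)" by (metis scaleR_scaleR)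
    then have "u F = k a *\<^sub>R W (flip a)" using k(2)[OF a(1)] by simp
    also have "\<dots> = w (p F)"
      using k(1)[OF a(1)] a(2) by (simp add: w_def linear_scale[OF linear_flip] linear_scale[OF W(1)])
    finally show ?thesis .
  qed
  ultimately show "\<exists>w. trivial_motion w \<and> (\<forall>F\<in>hyp_facets M. u F = w (p F))" by blast
qed

end

section \<open>Reduction to an irredundant set of half-spaces\<close>

text \<open>If \<open>z\<close> lay on the wall of \<open>p\<close>, moving it slightly in direction
  \<open>p\<close> and projecting back to hyperbolic space would leave the half-space while staying
  in the neighbourhood \<open>V\<close> of \<open>z\<close>.\<close>

lemma interior_strict:
  fixes P :: "'n::finite lspace set"
  assumes P: "P \<subseteq> de_sitter" and z: "z \<in> (top_of_set hyp_space) interior_of (hyp_space \<inter> lcone P)"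
    and p: "p \<in> P"
  shows "lorentz p z < 0"
proof -
  obtain V where V: "open V" "z \<in> hyp_space \<inter> V" "hyp_space \<inter> V \<subseteq> lcone P"
    using z by (auto simp: interior_of_def openin_open)
  have "lorentz p z \<le> 0" using V p by (auto simp: lcone_def)
  moreover have "lorentz p z \<noteq> 0"
  proof
    assume pz: "lorentz p z = 0"
    have pp: "lorentz p p = 1" using P p by (auto simp: de_sitter_def)
    have zz: "lorentz z z = -1" "snd z > 0" using V(2) by (auto simp: hyp_space_def)
    define x where "x t = z + t *\<^sub>R p" for t :: real
    have xx: "lorentz (x t) (x t) = t\<^sup>2 - 1" for t
      using pz pp zz by (simp add: x_def lorentz_simps lorentz_commute[of z p] power2_eq_square)
    have lim_x: "(x \<longlongrightarrow> z) (at_right 0)"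
      unfolding x_def by (rule tendsto_eq_intros | simp)+
    have "((\<lambda>t. 1 / sqrt (1 - t\<^sup>2)) \<longlongrightarrow> 1) (at_right (0::real))"
      by (rule tendsto_eq_intros | simp)+
    then have lim: "((\<lambda>t. nrm (x t)) \<longlongrightarrow> z) (at_right 0)"
      unfolding nrm_def xx using tendsto_scaleR[OF _ lim_x] by fastforce
    have "\<forall>\<^sub>F t in at_right 0. nrm (x t) \<in> V" using lim V(1,2) by (simp add: topological_tendstoD)
    moreover have "\<forall>\<^sub>F t in at_right 0. 0 < snd (x t)"
      using tendsto_snd[OF lim_x] zz(2) by (rule order_tendstoD(1))
    moreover have "\<forall>\<^sub>F t in at_right (0::real). t \<in> {0<..<1}" by (rule eventually_at_right_real) simp
    ultimately have "\<forall>\<^sub>F t in at_right (0::real). False"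
    proof eventually_elim
      case (elim t)
      have "t\<^sup>2 < 1" using elim(3) by (simp add: power_less_one_iff)
      then have fut: "future (x t)" using elim(2) by (simp add: future_def xx)
      then have "nrm (x t) \<in> lcone P" using nrm_hyp_space[OF fut] elim(1) V(3) by blast
      moreover obtain c where "c > 0" "nrm (x t) = c *\<^sub>R x t" using nrm_pos[OF fut] by blast
      ultimately have "lorentz p (x t) \<le> 0" using p by (auto simp: lcone_def lorentz_simps mult_le_0_iff)
      then show False using elim(3) pz pp by (simp add: x_def lorentz_simps)
    qed
    then show False by simp
  qed
  ultimately show ?thesis by simp
qed

theorem mainTheorem6:
  fixes M :: "'n::finite lspace set"
  assumes "CARD('n) \<ge> 3"
    and "hyp_polytope M"
    and "simple_polytope M"
  shows "stiff M"
proof -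
  obtain P where P: "finite P" "P \<subseteq> de_sitter" "M = hyp_space \<inter> (\<Inter>p\<in>P. hyp_halfspace p)"
    using assms(2) by (auto simp: hyp_polytope_def)
  have MP: "M = hyp_space \<inter> lcone P" using P(3) by (auto simp: hyp_halfspace_def lcone_def)
  \<comment> \<open>A minimal subset of \<open>P\<close> with the same cone is irredundant: if every
    point satisfying the other constraints also satisfied that of \<open>a\<close>, then
    \<open>a\<close> could be dropped.\<close>
  define \<B> where "\<B> = {B. B \<subseteq> P \<and> lcone B = lcone P}"
  have "finite \<B>" "P \<in> \<B>" using P(1) by (auto simp: \<B>_def)
  then obtain A where A\<B>: "A \<in> \<B>" and minimal: "\<And>B. B \<in> \<B> \<Longrightarrow> B \<subseteq> A \<Longrightarrow> A = B"
    using finite_has_minimal[of \<B>] by (metis empty_iff)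
  then have A: "A \<subseteq> P" "lcone A = lcone P" by (auto simp: \<B>_def)
  have M: "M = hyp_space \<inter> lcone A" by (simp add: MP A(2))
  obtain z where z: "z \<in> (top_of_set hyp_space) interior_of M"
    using assms(2) by (auto simp: hyp_polytope_def)
  have "hyp_cone A z"
  proof
    show "finite A" using P(1) A(1) finite_subset by blast
    show A_sitter: "A \<subseteq> de_sitter" using P(2) A(1) by blast
    show "3 \<le> CARD('n)" by (rule assms(1))
    show "hyp_bounded (hyp_space \<inter> lcone A)" using assms(2) M by (simp add: hyp_polytope_def)
    show "z \<in> hyp_space" using z interior_of_subset[of "top_of_set hyp_space" M] M by auto
    show "lorentz a z < 0" if "a \<in> A" for a using interior_strict[OF A_sitter z[unfolded M] that] .
    show "\<exists>x. lorentz a x > 0 \<and> (\<forall>b\<in>A - {a}. lorentz b x \<le> 0)" if a: "a \<in> A" for a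
    proof (rule ccontr)
      assume "\<not> ?thesis"
      then have "lcone (A - {a}) \<subseteq> lcone A" by (force simp: lcone_def not_less)
      then have "lcone (A - {a}) = lcone P" using A(2) by (auto simp: lcone_def)
      then have "A = A - {a}" using A(1) by (intro minimal) (auto simp: \<B>_def)
      then show False using a by blast
    qed
  qed
  then interpret hyp_cone A z .
  show ?thesis using stiff_M assms(3) M by simp
qed

end
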